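(* Let $(X,d)$ be a metric space and $K:X\to[0,+\infty)$ a function such that: (i) $(X,d)$ is a proper length metric space; (ii) $K$ is continuous and $\Sigma:=\{x\in X:K(x)=0\}$ is finite (and non-empty); (iii) there is a function $k\in C^0([0,+\infty),[0,+\infty))$ with $\int_0^\infty k(t)\,dt=+\infty$ such that $K(x)\ge k(d(x,\Sigma))$ for all $x\in X$. Then $d_K$ is a metric on $X$. Moreover: 1. $d_K$ and $d$ are equivalent (i.e. they induce the same topology) on all $d$-compact subsets of $X$. 2. $(X,d_K)$ is a proper metric space. 3. For every interval $I$, any ($d$-)locally Lipschitz curve $\gamma:I\to X$ is also $d_K$-locally Lipschitz, and the metric derivative of $\gamma$ in $(X,d_K)$, denoted by $|\dot\gamma|_K$, is given by $|\dot\gamma|_K(t)=K(\gamma(t))\,|\dot\gamma|(t)$ for a.e. $t\in I$. 4. For every interval $I$ and every $\gamma\in\mathcal{L}_{ploc}(I,X)$, $L_K(\gamma)=L_{d_K}(\gamma)$.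
   Context: Curves. A curve in a metric space $(X,d)$ is a continuous map $\gamma:I\to X$, with $I\subset\mathbb{R}$ a non-empty interval. $\mathcal{L}_{loc}(I,X)$ denotes the set of locally Lipschitz maps $I\to X$ (with respect to $d$). The set of piecewise locally Lipschitz maps (with respect to $d$) is $$\mathcal{L}_{ploc}(I,X):=\{\gamma\in C(I,X):\exists\, t_0=\inf I<t_1<\dots<t_n=\sup I,\ \forall i,\ \gamma|_{I\cap(t_i,t_{i+1})}\in\mathcal{L}_{loc}(I\cap(t_i,t_{i+1}),X)\}$$ (where $t_0$, $t_n$ may be infinite). Metric derivative. For $\gamma\in\mathcal{L}_{ploc}(I,X)$, the metric derivative $|\dot\gamma|(t)=\lim_{s\to t}\frac{d(\gamma(t),\gamma(s))}{|t-s|}$ exists for a.e. $t\in I$ and is measurable; the metric derivative $|\dot\gamma|_K$ in $(X,d_K)$ is defined by the same formula with $d_K$ in place of $d$. Paths. $\gamma:x^-\mapsto x^+$ means that $\gamma$ is a path from $x^-$ to $x^+$: there are $a^-\le a^+$ with $\gamma\in C^0([a^-,a^+],X)$ and $\gamma(a^\pm)=x^\pm$; infinite $a^\pm$ are allowed, with the convention $\gamma(\pm\infty):=\lim_{t\to\pm\infty}\gamma(t)$, the limit being required to exist. Lengths, length spaces and proper spaces. For a metric $\delta$ on $X$, the length of a curve is $L_\delta(\gamma):=\sup\sum_{i=0}^{N-1}\delta(\gamma(t_i),\gamma(t_{i+1}))\in[0,+\infty]$, the supremum being over all $N\ge1$ and $t_0\le\dots\le t_N$ in $I$; this is used for $\delta=d$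 and $\delta=d_K$. $(X,d)$ is a length space if $d(x,y)=\inf\{L_d(\gamma):\gamma:x\mapsto y\}$ for all $x,y\in X$. A metric space is proper if every bounded closed subset is compact. $d(x,\Sigma):=\inf_{z\in\Sigma}d(x,z)$. Weighted length. For $\gamma\in\mathcal{L}_{ploc}(I,X)$, $L_K(\gamma):=\int_I K(\gamma(t))\,|\dot\gamma|(t)\,dt$, and for $x,y\in X$, $$d_K(x,y):=\inf\{L_K(\gamma)\;:\;\gamma\in\mathcal{L}_{ploc}(I,X),\ \gamma:x\mapsto y\}$$ (the infimum is over all intervals $I$ and all such curves). *)

theory Defs
  imports "HOL-Analysis.Analysis"
begin

text \<open>
  The metric space \<open>(X, d)\<close> is a type of class \<^class>\<open>metric_space\<close> with \<open>d = dist\<close>. Notions that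
  are also needed for a second metric on the same space take the distance function \<open>\<delta>\<close> as an
  explicit argument. A curve is a total function together with its (real) interval of definition
  \<open>I\<close>; only its values on \<open>I\<close> matter.
\<close>

definition proper_metric_space :: "'a set \<Rightarrow> ('a \<Rightarrow> 'a \<Rightarrow> real) \<Rightarrow> bool" where
  "proper_metric_space X \<delta> \<longleftrightarrow> Metric_space X \<delta> \<and>
     (\<forall>S. Metric_space.mbounded X \<delta> S \<and> closedin (Metric_space.mtopology X \<delta>) S \<longrightarrow>
          compactin (Metric_space.mtopology X \<delta>) S)"

definition loc_lipschitz :: "('a \<Rightarrow> 'a \<Rightarrow> real) \<Rightarrow> real set \<Rightarrow> (real \<Rightarrow> 'a) \<Rightarrow> bool" where
  "loc_lipschitz \<delta> I \<gamma> \<longleftrightarrow>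
     (\<forall>t\<in>I. \<exists>e>0. \<exists>L. \<forall>r\<in>I \<inter> ball t e. \<forall>s\<in>I \<inter> ball t e. \<delta> (\<gamma> r) (\<gamma> s) \<le> L * \<bar>r - s\<bar>)"

text \<open>For a one-point interval, \<open>n = 0\<close> is the only possibility and the last condition is void.\<close>

definition piecewise_loc_lipschitz :: "real set \<Rightarrow> (real \<Rightarrow> 'a::metric_space) \<Rightarrow> bool" where
  "piecewise_loc_lipschitz I \<gamma> \<longleftrightarrow> continuous_on I \<gamma> \<and>
     (\<exists>n (t :: nat \<Rightarrow> ereal).
        t 0 = Inf (ereal ` I) \<and> t n = Sup (ereal ` I) \<and> (\<forall>i<n. t i < t (Suc i)) \<and>
        (\<forall>i<n. loc_lipschitz dist (I \<inter> {s. t i < ereal s \<and> ereal s < t (Suc i)}) \<gamma>))"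

definition has_metric_deriv ::
    "('a \<Rightarrow> 'a \<Rightarrow> real) \<Rightarrow> real set \<Rightarrow> (real \<Rightarrow> 'a) \<Rightarrow> real \<Rightarrow> real \<Rightarrow> bool" where
  "has_metric_deriv \<delta> I \<gamma> t v \<longleftrightarrow>
     ((\<lambda>s. \<delta> (\<gamma> t) (\<gamma> s) / \<bar>t - s\<bar>) \<longlongrightarrow> v) (at t within I)"

text \<open>Meaningful only where the limit exists, which for \<open>\<delta> = dist\<close> and a piecewise locally
  Lipschitz curve is the case at almost every \<open>t \<in> I\<close>.\<close>

definition metric_deriv ::
    "('a \<Rightarrow> 'a \<Rightarrow> real) \<Rightarrow> real set \<Rightarrow> (real \<Rightarrow> 'a) \<Rightarrow> real \<Rightarrow> real" where
  "metric_deriv \<delta> I \<gamma> t = Lim (at t within I) (\<lambda>s. \<delta> (\<gamma> t) (\<gamma> s) / \<bar>t - s\<bar>)"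

text \<open>\<open>I\<close> is the set of real points of \<open>[a, b]\<close>. As it is required to be non-empty, \<open>a < \<infinity>\<close> and
  \<open>b > - \<infinity>\<close>, so the limits at infinity only see values of \<open>\<gamma>\<close> on \<open>I\<close>.\<close>

definition path_from_to :: "real set \<Rightarrow> (real \<Rightarrow> 'a::metric_space) \<Rightarrow> 'a \<Rightarrow> 'a \<Rightarrow> bool" where
  "path_from_to I \<gamma> x y \<longleftrightarrow> I \<noteq> {} \<and> continuous_on I \<gamma> \<and>
     (\<exists>a b :: ereal. a \<le> b \<and> I = {t. a \<le> ereal t \<and> ereal t \<le> b} \<and>
        (if a = - \<infinity> then (\<gamma> \<longlongrightarrow> x) at_bot else \<gamma> (real_of_ereal a) = x) \<and>
        (if b = \<infinity> then (\<gamma> \<longlongrightarrow> y) at_top else \<gamma> (real_of_ereal b) = y))"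

definition curve_length :: "('a \<Rightarrow> 'a \<Rightarrow> real) \<Rightarrow> real set \<Rightarrow> (real \<Rightarrow> 'a) \<Rightarrow> ennreal" where
  "curve_length \<delta> I \<gamma> =
     Sup {(\<Sum>i<N. ennreal (\<delta> (\<gamma> (t i)) (\<gamma> (t (Suc i))))) | N (t :: nat \<Rightarrow> real).
          N \<ge> 1 \<and> (\<forall>i\<le>N. t i \<in> I) \<and> (\<forall>i<N. t i \<le> t (Suc i))}"

definition length_space :: "'a::metric_space itself \<Rightarrow> bool" where
  "length_space _ \<longleftrightarrow>
     (\<forall>x y :: 'a. ennreal (dist x y) = Inf {curve_length dist I \<gamma> | I \<gamma>. path_from_to I \<gamma> x y})"

definition weighted_length :: "('a::metric_space \<Rightarrow> real) \<Rightarrow> real set \<Rightarrow> (real \<Rightarrow> 'a) \<Rightarrow> ennreal" where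
  "weighted_length K I \<gamma> =
     (\<integral>\<^sup>+t\<in>I. ennreal (K (\<gamma> t) * metric_deriv dist I \<gamma> t) \<partial>lebesgue)"

definition weighted_edist :: "('a::metric_space \<Rightarrow> real) \<Rightarrow> 'a \<Rightarrow> 'a \<Rightarrow> ennreal" where
  "weighted_edist K x y =
     Inf {weighted_length K I \<gamma> | I \<gamma>. piecewise_loc_lipschitz I \<gamma> \<and> path_from_to I \<gamma> x y}"

text \<open>Since \<^const>\<open>enn2real\<close> maps \<open>\<infinity>\<close> to \<open>0\<close>, this represents \<^const>\<open>weighted_edist\<close> only where
  the latter is finite; finiteness has to be asserted separately.\<close>

definition weighted_dist :: "('a::metric_space \<Rightarrow> real) \<Rightarrow> 'a \<Rightarrow> 'a \<Rightarrow> real" where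
  "weighted_dist K x y = enn2real (weighted_edist K x y)"

end

theory Submission
  imports Defs
begin

text \<open>
  Write \<open>d\<close> for the given metric, \<open>\<Sigma>\<close> for the zero set of \<open>K\<close> and \<open>d\<^sub>K\<close> for the weighted distance. The
  heart of the matter is that \<open>d\<^sub>K\<close> is, to first order, the metric \<open>d\<close> multiplied by \<open>K\<close>:
  \<open>d\<^sub>K(x, y) = (K(x) + o(1)) d(x, y)\<close> as \<open>y\<close> tends to \<open>x\<close> (\<open>weighted_dist_asymptotic\<close>).

  The upper bound comes from geodesics, which exist in a proper length space (\<open>geodesic_exists\<close>):
  running along one from \<open>x\<close> to \<open>y\<close> costs at most \<open>d(x, y)\<close> times the supremum of \<open>K\<close> on the ball of
  that radius (\<open>lipschitz_cost_le_dist\<close>). All lower bounds come from one principle: if \<open>K\<close> dominates the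
  pointwise slope of a real function \<open>\<Phi>\<close>, then \<open>\<Phi>\<close> varies along a curve by at most its weighted length
  (\<open>upper_gradient_increment\<close>). For a clamped multiple of the distance from \<open>x\<close> this bounds the cost of
  crossing an annulus from below, which gives the lower half of the asymptotics. As \<open>\<Sigma>\<close> is finite,
  every point is surrounded by thin annuli free of zeros, so \<open>d\<^sub>K\<close> separates points and induces the
  same topology as \<open>d\<close>. For the primitive of \<open>k\<close> evaluated at the distance from \<open>\<Sigma>\<close> it shows that
  \<open>d\<^sub>K\<close>-bounded sets are \<open>d\<close>-bounded, whence properness.

  The formula for the metric derivative follows from the asymptotics wherever the derivative in \<open>d\<close>
  exists. That it exists almost everywhere (\<open>Lipschitz_metric_derivative_exists\<close>) is shown by an energy
  argument: the sums \<open>\<Sum> d\<^sup>2 / h\<close> over partitions increase under refinement and are bounded for a Lipschitz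
  curve, and a partition that nearly attains the supremum leaves little energy for slopes to oscillate
  on smaller scales. The Vitali covering theorem makes this precise.

  In the length formula, the length in \<open>d\<^sub>K\<close> is at most the weighted length because every arc of the curve
  competes in the definition of \<open>d\<^sub>K\<close>; the converse is Fatou's lemma applied to the difference quotients
  in \<open>d\<^sub>K\<close>.

  Paths may have infinite ends and finitely many points near which they are not Lipschitz. Both are dealt
  with once: \<open>d\<^sub>K\<close> equals the infimum over Lipschitz curves on compact intervals
  (\<open>weighted_edist_eq_lipschitz_cost\<close>), because the bad parts can be replaced by short geodesics of
  negligible cost.
\<close>

section \<open>Superadditive interval functions and fine covers\<close>

text \<open>
  The intervals can be sorted. Removing the rightmost one, superadditivity splits the total at its
  left end, and the remaining intervals lie to the left of that point. Intervals are given as balls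
  because the Vitali covering theorem produces them in this form.
\<close>

lemma superadditive_sum_le:
  fixes m :: "real \<Rightarrow> real \<Rightarrow> real" and a r :: "'i \<Rightarrow> real"
  assumes "finite C" "u \<le> v"
    and nonneg: "\<And>x y. u \<le> x \<Longrightarrow> x \<le> y \<Longrightarrow> y \<le> v \<Longrightarrow> 0 \<le> m x y"
    and superadd: "\<And>x y z. u \<le> x \<Longrightarrow> x \<le> y \<Longrightarrow> y \<le> z \<Longrightarrow> z \<le> v \<Longrightarrow> m x y + m y z \<le> m x z"
    and pos: "\<And>i. i \<in> C \<Longrightarrow> 0 < r i"
    and sub: "\<And>i. i \<in> C \<Longrightarrow> u \<le> a i - r i \<and> a i + r i \<le> v"
    and disj: "pairwise (\<lambda>i j. disjnt (cball (a i) (r i)) (cball (a j) (r j))) C"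
  shows "(\<Sum>i\<in>C. m (a i - r i) (a i + r i)) \<le> m u v"
  using assms
proof (induction "card C" arbitrary: C v)
  case 0
  then show ?case by simp
next
  case (Suc n)
  have "C \<noteq> {}" "finite C" using Suc.hyps Suc.prems by auto
  then have "Max (a ` C) \<in> a ` C" by simp
  then obtain i where "i \<in> C" "Max (a ` C) = a i" by auto
  then have i: "i \<in> C" "\<And>j. j \<in> C \<Longrightarrow> a j \<le> a i"
    using \<open>finite C\<close> by (auto simp flip: \<open>Max (a ` C) = a i\<close>)
  have left: "a j + r j \<le> a i - r i" if "j \<in> C - {i}" for j
  proof (rule ccontr)
    assume "\<not> ?thesis"
    moreover have "0 < r j" "0 < r i" "a j \<le> a i" using that Suc.prems i by auto
    ultimately have "max (a j) (a i - r i) \<in> cball (a i) (r i) \<inter> cball (a j) (r j)"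
      by (auto simp: dist_real_def max_def abs_if)
    then show False
      using Suc.prems(7) that i unfolding pairwise_def disjnt_def by blast
  qed
  have ui: "u \<le> a i - r i" "a i + r i \<le> v" "0 < r i" using Suc.prems i by auto
  have "(\<Sum>j\<in>C - {i}. m (a j - r j) (a j + r j)) \<le> m u (a i - r i)"
  proof (rule Suc.hyps)
    show "n = card (C - {i})" using Suc.hyps(2) i by simp
    show "pairwise (\<lambda>i j. disjnt (cball (a i) (r i)) (cball (a j) (r j))) (C - {i})"
      using Suc.prems(7) by (rule pairwise_subset) auto
  qed (use Suc.prems ui left in \<open>auto\<close>)
  moreover have "(\<Sum>j\<in>C. m (a j - r j) (a j + r j)) =
      m (a i - r i) (a i + r i) + (\<Sum>j\<in>C - {i}. m (a j - r j) (a j + r j))"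
    using i Suc.prems(1) by (simp add: sum.remove)
  moreover have "m u (a i - r i) + m (a i - r i) (a i + r i) \<le> m u (a i + r i)"
    using Suc.prems(4)[of u "a i - r i" "a i + r i"] ui by auto
  moreover have "m u (a i + r i) + m (a i + r i) v \<le> m u v" "0 \<le> m (a i + r i) v"
    using Suc.prems(4)[of u "a i + r i" v] Suc.prems(3)[of "a i + r i" v] ui by auto
  ultimately show ?case by linarith
qed

text \<open>
  A weak-type estimate with constant one. The Vitali covering theorem selects from the fine cover
  countably many disjoint intervals that cover \<open>S\<close> up to a null set; their total length is at most
  \<open>1 / c\<close> times the sum of the values of \<open>m\<close>, which superadditivity bounds by \<open>m u v\<close>. As \<open>S\<close>
  may fail to be measurable, the bound is stated for a measurable set \<open>T\<close> that contains it.
\<close>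

lemma superadditive_fine_cover:
  fixes m :: "real \<Rightarrow> real \<Rightarrow> real"
  assumes "u \<le> v" "0 < c"
    and nonneg: "\<And>x y. u \<le> x \<Longrightarrow> x \<le> y \<Longrightarrow> y \<le> v \<Longrightarrow> 0 \<le> m x y"
    and superadd: "\<And>x y z. u \<le> x \<Longrightarrow> x \<le> y \<Longrightarrow> y \<le> z \<Longrightarrow> z \<le> v \<Longrightarrow> m x y + m y z \<le> m x z"
    and S: "S \<subseteq> {u<..<v}"
    and fine: "\<And>t e. t \<in> S \<Longrightarrow> 0 < e \<Longrightarrow>
                 \<exists>p q. p < q \<and> q - p < e \<and> t \<in> {p..q} \<and> c * (q - p) \<le> m p q"
  shows "\<exists>T. S \<subseteq> T \<and> T \<in> lmeasurable \<and> measure lebesgue T \<le> m u v / c"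
proof -
  define K where "K = {(p, q). u \<le> p \<and> p < q \<and> q \<le> v \<and> c * (q - p) \<le> m p q}"
  define a where "a = (\<lambda>(p, q). (p + q) / 2 :: real)"
  define r where "r = (\<lambda>(p, q). (q - p) / 2 :: real)"
  have ends: "a i - r i = fst i" "a i + r i = snd i" for i
    by (auto simp: a_def r_def field_simps split: prod.split)
  have ball: "cball (a i) (r i) = {fst i..snd i}" for i
    by (simp add: cball_eq_atLeastAtMost ends)
  have pos: "0 < r i" if "i \<in> K" for i
    using that by (auto simp: K_def r_def)
  have cover: "\<exists>i. i \<in> K \<and> t \<in> cball (a i) (r i) \<and> r i < e" if t: "t \<in> S" "0 < e" for t e
  proof -
    (* Intervals containing t that are shorter than its distance to the boundary stay inside [u, v]. *)
    have "0 < min e (min (t - u) (v - t))" using t S by auto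
    then obtain p q where pq: "p < q" "q - p < min e (min (t - u) (v - t))" "t \<in> {p..q}"
        "c * (q - p) \<le> m p q"
      using fine[OF t(1)] by blast
    then have "(p, q) \<in> K" by (auto simp: K_def)
    moreover have "t \<in> cball (a (p, q)) (r (p, q))" using pq by (simp add: ball)
    moreover have "r (p, q) < e" using pq by (simp add: r_def)
    ultimately show ?thesis by blast
  qed
  obtain C where C: "countable C" "C \<subseteq> K"
      "pairwise (\<lambda>i j. disjnt (cball (a i) (r i)) (cball (a j) (r j))) C"
      "negligible (S - (\<Union>i\<in>C. cball (a i) (r i)))"
    using Vitali_covering_theorem_cballs[of K r S a] pos cover by blast
  let ?U = "\<Union>i\<in>C. cball (a i) (r i)"
  have bound: "measure lebesgue (\<Union>i\<in>D. cball (a i) (r i)) \<le> m u v / c"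
    if D: "D \<subseteq> C" "finite D" for D
  proof -
    have DK: "D \<subseteq> K" using D C by auto
    have "measure lebesgue (\<Union>i\<in>D. cball (a i) (r i)) \<le> (\<Sum>i\<in>D. measure lebesgue (cball (a i) (r i)))"
      using D by (intro measure_UNION_le) auto
    also have "\<dots> = (\<Sum>i\<in>D. snd i - fst i)"
      using DK by (intro sum.cong) (auto simp: ball K_def)
    also have "\<dots> \<le> (\<Sum>i\<in>D. m (a i - r i) (a i + r i) / c)"
    proof (rule sum_mono)
      fix i assume "i \<in> D"
      then have "i \<in> K" using DK by auto
      then have "c * (snd i - fst i) \<le> m (fst i) (snd i)" by (auto simp: K_def)
      then show "snd i - fst i \<le> m (a i - r i) (a i + r i) / c"
        using \<open>0 < c\<close> by (simp add: ends field_simps)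
    qed
    also have "\<dots> = (\<Sum>i\<in>D. m (a i - r i) (a i + r i)) / c"
      by (simp add: sum_divide_distrib)
    also have "\<dots> \<le> m u v / c"
    proof (intro divide_right_mono superadditive_sum_le)
      show "pairwise (\<lambda>i j. disjnt (cball (a i) (r i)) (cball (a j) (r j))) D"
        using C(3) D(1) by (rule pairwise_subset)
      show "\<And>i. i \<in> D \<Longrightarrow> u \<le> a i - r i \<and> a i + r i \<le> v"
        using DK by (auto simp: ends K_def)
    qed (use assms D DK pos in auto)
    finally show ?thesis .
  qed
  have U: "?U \<in> lmeasurable" "measure lebesgue ?U \<le> m u v / c"
    by (rule fmeasurable_UN_bound[OF C(1)] measure_UN_bound[OF C(1)], simp, erule (1) bound)+
  let ?N = "S - ?U"
  have "?N \<in> lmeasurable" "measure lebesgue ?N = 0"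
    using C(4) by (auto simp: negligible_iff_measure)
  then have "?N \<union> ?U \<in> lmeasurable"
    using U by (intro fmeasurable.Un)
  moreover have "measure lebesgue (?N \<union> ?U) \<le> measure lebesgue ?N + measure lebesgue ?U"
    using U \<open>?N \<in> lmeasurable\<close> by (intro measure_Un_le fmeasurableD)
  ultimately have "?N \<union> ?U \<in> lmeasurable" "measure lebesgue (?N \<union> ?U) \<le> m u v / c"
    using U \<open>measure lebesgue ?N = 0\<close> by auto
  then show ?thesis
    by (intro exI[of _ "?N \<union> ?U"]) auto
qed

section \<open>Almost everywhere existence of the metric derivative\<close>

definition slope :: "(real \<Rightarrow> 'a::metric_space) \<Rightarrow> real \<Rightarrow> real \<Rightarrow> real" where
  "slope \<gamma> t s = dist (\<gamma> t) (\<gamma> s) / \<bar>t - s\<bar>"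

lemma slope_commute: "slope \<gamma> t s = slope \<gamma> s t"
  by (simp add: slope_def dist_commute abs_minus_commute)

text \<open>
  The points at which the slopes keep oscillating by more than \<open>2 * \<eta>\<close> at every scale. Outside all
  of these sets the slopes form a Cauchy family, so that the metric derivative exists.
\<close>

definition osc :: "(real \<Rightarrow> 'a::metric_space) \<Rightarrow> real \<Rightarrow> real set" where
  "osc \<gamma> \<eta> = {t. \<forall>e>0. \<exists>s s'. s \<noteq> t \<and> s' \<noteq> t \<and> \<bar>s - t\<bar> < e \<and> \<bar>s' - t\<bar> < e \<and>
              2 * \<eta> < \<bar>slope \<gamma> t s - slope \<gamma> t s'\<bar>}"

text \<open>
  \<open>chain_energy \<gamma> u v s\<close> means that \<open>s\<close> is the discrete Dirichlet energy \<open>\<Sum> d\<^sup>2 / h\<close> of \<open>\<gamma>\<close> along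
  some partition of \<open>[u, v]\<close>. Generating partitions by joining two of them, rather than listing
  their points, makes the supremum superadditive by definition and turns statements about a
  partition into an induction.
\<close>

inductive chain_energy :: "(real \<Rightarrow> 'a::metric_space) \<Rightarrow> real \<Rightarrow> real \<Rightarrow> real \<Rightarrow> bool" for \<gamma> where
  single: "u \<le> v \<Longrightarrow> chain_energy \<gamma> u v ((dist (\<gamma> u) (\<gamma> v))\<^sup>2 / (v - u))"
| join: "chain_energy \<gamma> u w s \<Longrightarrow> chain_energy \<gamma> w v s' \<Longrightarrow> chain_energy \<gamma> u v (s + s')"

lemma chain_energy_mono: "chain_energy \<gamma> u v s \<Longrightarrow> u \<le> v"
  by (induction rule: chain_energy.induct) auto

lemma chain_energy_bounds:
  assumes "chain_energy \<gamma> u v s" "C-lipschitz_on {a..b} \<gamma>" "a \<le> u" "v \<le> b"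
  shows "0 \<le> s" "s \<le> C\<^sup>2 * (v - u)"
proof -
  have "0 \<le> s \<and> s \<le> C\<^sup>2 * (v - u)"
    using assms(1,3,4)
  proof induction
    case (single u v)
    have "dist (\<gamma> u) (\<gamma> v) \<le> C * (v - u)"
      using lipschitz_onD[OF assms(2), of u v] single by (simp add: dist_real_def)
    then have "(dist (\<gamma> u) (\<gamma> v))\<^sup>2 \<le> (C * (v - u))\<^sup>2"
      by (intro power_mono) auto
    then have "(dist (\<gamma> u) (\<gamma> v))\<^sup>2 / (v - u) \<le> (C * (v - u))\<^sup>2 / (v - u)"
      using single by (intro divide_right_mono) auto
    also have "\<dots> = C\<^sup>2 * (v - u)"
      by (simp add: power2_eq_square)
    finally show ?case using single by simp
  next
    case (join u w s v s')
    then show ?case using chain_energy_mono[OF join.hyps(1)] chain_energy_mono[OF join.hyps(2)]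
      by (auto simp: algebra_simps)
  qed
  then show "0 \<le> s" "s \<le> C\<^sup>2 * (v - u)" by auto
qed

definition energy :: "(real \<Rightarrow> 'a::metric_space) \<Rightarrow> real \<Rightarrow> real \<Rightarrow> real" where
  "energy \<gamma> u v = Sup {s. chain_energy \<gamma> u v s}"

context
  fixes \<gamma> :: "real \<Rightarrow> 'a::metric_space" and a b C :: real
  assumes lip: "C-lipschitz_on {a..b} \<gamma>"
begin

lemma chain_energy_le:
  assumes "chain_energy \<gamma> u v s" "a \<le> u" "v \<le> b"
  shows "s \<le> energy \<gamma> u v"
  unfolding energy_def
proof (rule cSup_upper)
  show "bdd_above {s. chain_energy \<gamma> u v s}"
    using chain_energy_bounds(2)[OF _ lip assms(2,3)] by (intro bdd_aboveI[of _ "C\<^sup>2 * (v - u)"]) simp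
qed (use assms in auto)

lemma energy_ge: 
  assumes "a \<le> u" "u \<le> v" "v \<le> b"
  shows "(dist (\<gamma> u) (\<gamma> v))\<^sup>2 / (v - u) \<le> energy \<gamma> u v"
  using chain_energy_le chain_energy.single assms by metis

lemma energy_superadditive:
  assumes "a \<le> u" "u \<le> w" "w \<le> v" "v \<le> b"
  shows "energy \<gamma> u w + energy \<gamma> w v \<le> energy \<gamma> u v"
proof -
  have "energy \<gamma> u w \<le> energy \<gamma> u v - energy \<gamma> w v"
    unfolding energy_def[of \<gamma> u w]
  proof (rule cSup_least)
    fix s assume s: "s \<in> {s. chain_energy \<gamma> u w s}"
    have "energy \<gamma> w v \<le> energy \<gamma> u v - s"
      unfolding energy_def[of \<gamma> w v]
    proof (rule cSup_least)
      fix s' assume "s' \<in> {s. chain_energy \<gamma> w v s}"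
      then show "s' \<le> energy \<gamma> u v - s"
        using chain_energy_le[OF chain_energy.join[of \<gamma> u w s v s']] s assms by auto
    qed (use chain_energy.single assms in blast)
    then show "s \<le> energy \<gamma> u v - energy \<gamma> w v" by simp
  qed (use chain_energy.single assms in blast)
  then show ?thesis by simp
qed

text \<open>
  On a single interval \<open>[u, v]\<close> with slope \<open>\<sigma>\<close>, completing the square shows that
  \<open>energy \<gamma> p q - 2 * \<sigma> * d (\<gamma> p) (\<gamma> q) + \<sigma>\<^sup>2 * (q - p)\<close> is at least
  \<open>(slope \<gamma> p q - \<sigma>)\<^sup>2 * (q - p)\<close>; by the triangle inequality it is superadditive in \<open>(p, q)\<close>, and on
  all of \<open>[u, v]\<close> it equals the energy defect. Near a point of oscillation one of two slopes differs
  from \<open>\<sigma>\<close> by more than \<open>\<eta>\<close>, so the covering estimate bounds the oscillation set by the defect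
  divided by \<open>\<eta>\<^sup>2\<close>. For a chain the defects add up.
\<close>

lemma osc_cover:
  assumes "0 < \<eta>" "chain_energy \<gamma> u v s" "a \<le> u" "v \<le> b"
  shows "\<exists>T. osc \<gamma> \<eta> \<inter> {u<..<v} \<subseteq> T \<and> T \<in> lmeasurable \<and>
             measure lebesgue T \<le> (energy \<gamma> u v - s) / \<eta>\<^sup>2"
  using assms(2-4)
proof induction
  case (single u v)
  show ?case
  proof (cases "u = v")
    case True
    then show ?thesis
      using energy_ge[of u v] single by (intro exI[of _ "{}"]) auto
  next
    case False
    then have uv: "u < v" using single by simp
    define \<sigma> where "\<sigma> = dist (\<gamma> u) (\<gamma> v) / (v - u)"
    define g where "g p q = energy \<gamma> p q - 2 * \<sigma> * dist (\<gamma> p) (\<gamma> q) + \<sigma>\<^sup>2 * (q - p)" for p q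
    have "0 \<le> \<sigma>" using uv by (simp add: \<sigma>_def)
    have g_ge: "(slope \<gamma> p q - \<sigma>)\<^sup>2 * (q - p) \<le> g p q" if "u \<le> p" "p < q" "q \<le> v" for p q
    proof -
      have "slope \<gamma> p q * (q - p) = dist (\<gamma> p) (\<gamma> q)"
        using that by (simp add: slope_def)
      moreover have "(slope \<gamma> p q)\<^sup>2 * (q - p) = (dist (\<gamma> p) (\<gamma> q))\<^sup>2 / (q - p)"
        using that by (simp add: slope_def power2_eq_square)
      moreover have "(slope \<gamma> p q - \<sigma>)\<^sup>2 * (q - p) =
          (slope \<gamma> p q)\<^sup>2 * (q - p) - 2 * \<sigma> * (slope \<gamma> p q * (q - p)) + \<sigma>\<^sup>2 * (q - p)"
        by (simp add: power2_eq_square algebra_simps)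
      moreover have "(dist (\<gamma> p) (\<gamma> q))\<^sup>2 / (q - p) \<le> energy \<gamma> p q"
        using that single by (intro energy_ge) auto
      ultimately show ?thesis by (simp add: g_def)
    qed
    have "\<exists>T. osc \<gamma> \<eta> \<inter> {u<..<v} \<subseteq> T \<and> T \<in> lmeasurable \<and> measure lebesgue T \<le> g u v / \<eta>\<^sup>2"
    proof (rule superadditive_fine_cover[where m = g and u = u and v = v])
      show "0 < \<eta>\<^sup>2" "u \<le> v" "osc \<gamma> \<eta> \<inter> {u<..<v} \<subseteq> {u<..<v}" using assms uv by auto
      show "0 \<le> g p q" if "u \<le> p" "p \<le> q" "q \<le> v" for p q
      proof (cases "p = q")
        case True
        then show ?thesis using energy_ge[of p p] that single by (simp add: g_def)
      next
        case False
        then have "0 \<le> (slope \<gamma> p q - \<sigma>)\<^sup>2 * (q - p)" using that by simp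
        also have "\<dots> \<le> g p q" using g_ge[of p q] that False by simp
        finally show ?thesis .
      qed
      show "g x y + g y z \<le> g x z" if "u \<le> x" "x \<le> y" "y \<le> z" "z \<le> v" for x y z
      proof -
        have "\<sigma> * dist (\<gamma> x) (\<gamma> z) \<le> \<sigma> * (dist (\<gamma> x) (\<gamma> y) + dist (\<gamma> y) (\<gamma> z))"
          using \<open>0 \<le> \<sigma>\<close> by (intro mult_left_mono dist_triangle)
        moreover have "energy \<gamma> x y + energy \<gamma> y z \<le> energy \<gamma> x z"
          using that single by (intro energy_superadditive) auto
        ultimately show ?thesis by (simp add: g_def algebra_simps)
      qed
      show "\<exists>p q. p < q \<and> q - p < e \<and> t \<in> {p..q} \<and> \<eta>\<^sup>2 * (q - p) \<le> g p q"
        if t: "t \<in> osc \<gamma> \<eta> \<inter> {u<..<v}" and e: "0 < e" for t e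
      proof -
        (* Both comparison points are taken inside (u, v), where the energy is controlled. *)
        have "0 < min e (min (t - u) (v - t))" using t e by auto
        then obtain s s' where s: "s \<noteq> t" "s' \<noteq> t" "\<bar>s - t\<bar> < min e (min (t - u) (v - t))"
            "\<bar>s' - t\<bar> < min e (min (t - u) (v - t))"
            "2 * \<eta> < \<bar>slope \<gamma> t s - slope \<gamma> t s'\<bar>"
          using t unfolding osc_def by blast
        have "\<eta> < \<bar>slope \<gamma> t s - \<sigma>\<bar> \<or> \<eta> < \<bar>slope \<gamma> t s' - \<sigma>\<bar>"
          using s(5) by linarith
        then obtain z where z: "z \<noteq> t" "\<bar>z - t\<bar> < min e (min (t - u) (v - t))"
            "\<eta> < \<bar>slope \<gamma> t z - \<sigma>\<bar>"
          using s by blast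
        define p q where "p = min t z" and "q = max t z"
        have pq: "p < q" "q - p < e" "t \<in> {p..q}" "u \<le> p" "q \<le> v"
          using z by (auto simp: p_def q_def min_def max_def abs_if split: if_splits)
        have "slope \<gamma> p q = slope \<gamma> t z"
          by (simp add: p_def q_def min_def max_def slope_commute)
        then have "\<eta>\<^sup>2 \<le> (slope \<gamma> p q - \<sigma>)\<^sup>2"
          using z assms(1) by (simp add: abs_le_square_iff[symmetric])
        then have "\<eta>\<^sup>2 * (q - p) \<le> (slope \<gamma> p q - \<sigma>)\<^sup>2 * (q - p)"
          using pq by (intro mult_right_mono) auto
        also have "\<dots> \<le> g p q"
          using g_ge pq by blast
        finally show ?thesis
          using pq by blast
      qed
    qed
    (* By the choice of \<sigma>, the mixed term is twice the last one. *)
    moreover have "g u v = energy \<gamma> u v - (dist (\<gamma> u) (\<gamma> v))\<^sup>2 / (v - u)"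
      using uv by (simp add: g_def \<sigma>_def power2_eq_square)
    ultimately show ?thesis by simp
  qed
next
  case (join u w s v s')
  have uwv: "u \<le> w" "w \<le> v"
    using chain_energy_mono join.hyps by auto
  obtain T where T: "osc \<gamma> \<eta> \<inter> {u<..<w} \<subseteq> T" "T \<in> lmeasurable"
      "measure lebesgue T \<le> (energy \<gamma> u w - s) / \<eta>\<^sup>2"
    using join uwv by auto
  obtain T' where T': "osc \<gamma> \<eta> \<inter> {w<..<v} \<subseteq> T'" "T' \<in> lmeasurable"
      "measure lebesgue T' \<le> (energy \<gamma> w v - s') / \<eta>\<^sup>2"
    using join uwv by auto
  have "measure lebesgue (T \<union> T' \<union> {w}) \<le> measure lebesgue (T \<union> T') + measure lebesgue {w}"
    using T T' by (intro measure_Un_le) (auto simp: fmeasurableD)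
  also have "\<dots> \<le> measure lebesgue T + measure lebesgue T'"
    using T T' measure_Un_le[of T lebesgue T'] by (auto simp: fmeasurableD)
  also have "\<dots> \<le> (energy \<gamma> u w - s) / \<eta>\<^sup>2 + (energy \<gamma> w v - s') / \<eta>\<^sup>2"
    using T T' by simp
  also have "\<dots> = (energy \<gamma> u w + energy \<gamma> w v - (s + s')) / \<eta>\<^sup>2"
    by (simp add: diff_divide_distrib add_divide_distrib)
  also have "\<dots> \<le> (energy \<gamma> u v - (s + s')) / \<eta>\<^sup>2"
    using join.prems uwv by (intro divide_right_mono diff_right_mono energy_superadditive) auto
  finally have "measure lebesgue (T \<union> T' \<union> {w}) \<le> (energy \<gamma> u v - (s + s')) / \<eta>\<^sup>2" .
  moreover have "osc \<gamma> \<eta> \<inter> {u<..<v} \<subseteq> T \<union> T' \<union> {w}"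
    using T(1) T'(1) by (auto simp: subset_iff) (meson linorder_cases)
  moreover have "T \<union> T' \<union> {w} \<in> lmeasurable"
    using T T' negligible_imp_measurable[OF negligible_sing, of w] by (intro fmeasurable.Un)
  ultimately show ?case by blast
qed

text \<open>
  Chains come arbitrarily close to the supremal energy, so the defect in the covering estimate can be
  made as small as desired.
\<close>

lemma negligible_osc:
  assumes "0 < \<eta>"
  shows "negligible (osc \<gamma> \<eta> \<inter> {a<..<b})"
proof (cases "a < b")
  case True
  show ?thesis
    unfolding negligible_outer_le
  proof (intro allI impI)
    fix e :: real assume "0 < e"
    then have "energy \<gamma> a b - e * \<eta>\<^sup>2 < energy \<gamma> a b"
      using assms by simp
    moreover have "{s. chain_energy \<gamma> a b s} \<noteq> {}"
      using chain_energy.single True less_imp_le by blast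
    ultimately have "\<exists>s\<in>{s. chain_energy \<gamma> a b s}. energy \<gamma> a b - e * \<eta>\<^sup>2 < s"
      unfolding energy_def by (intro less_cSupD)
    then obtain s where s: "chain_energy \<gamma> a b s" "energy \<gamma> a b - e * \<eta>\<^sup>2 < s"
      by blast
    then have "(energy \<gamma> a b - s) / \<eta>\<^sup>2 \<le> e"
      using assms by (simp add: field_simps)
    then show "\<exists>T. osc \<gamma> \<eta> \<inter> {a<..<b} \<subseteq> T \<and> T \<in> lmeasurable \<and> measure lebesgue T \<le> e"
      using osc_cover[OF assms s(1)] by (meson order.refl order.trans)
  qed
qed auto

end

lemma slope_converges:
  assumes "\<And>n. t \<notin> osc \<gamma> (1 / real (Suc n))"
  shows "\<exists>l. (slope \<gamma> t \<longlongrightarrow> l) (at t)"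
proof -
  have "cauchy_filter (filtermap (slope \<gamma> t) (at t))"
    unfolding cauchy_filter_metric
  proof (intro allI impI)
    fix e :: real assume "0 < e"
    then obtain n where n: "2 / real (Suc n) < e"
      using reals_Archimedean[of "e / 2"] by (auto simp: field_simps)
    have "\<not> (\<forall>d>0. \<exists>s s'. s \<noteq> t \<and> s' \<noteq> t \<and> \<bar>s - t\<bar> < d \<and> \<bar>s' - t\<bar> < d \<and>
        2 * (1 / real (Suc n)) < \<bar>slope \<gamma> t s - slope \<gamma> t s'\<bar>)"
      using assms[of n] unfolding osc_def mem_Collect_eq .
    then obtain d where d: "0 < d" "\<And>s s'. s \<noteq> t \<Longrightarrow> s' \<noteq> t \<Longrightarrow> \<bar>s - t\<bar> < d \<Longrightarrow> \<bar>s' - t\<bar> < d \<Longrightarrow>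
        \<not> 2 * (1 / real (Suc n)) < \<bar>slope \<gamma> t s - slope \<gamma> t s'\<bar>"
      by metis
    let ?P = "\<lambda>y. \<exists>s. s \<noteq> t \<and> \<bar>s - t\<bar> < d \<and> y = slope \<gamma> t s"
    have "eventually ?P (filtermap (slope \<gamma> t) (at t))"
      using d(1) unfolding eventually_filtermap eventually_at dist_real_def by blast
    moreover have "dist x y < e" if xy: "?P x \<and> ?P y" for x y
    proof -
      obtain s s' where "s \<noteq> t" "\<bar>s - t\<bar> < d" "x = slope \<gamma> t s" "s' \<noteq> t" "\<bar>s' - t\<bar> < d" "y = slope \<gamma> t s'"
        using xy by blast
      then show ?thesis using d(2)[of s s'] n by (simp add: dist_real_def)
    qed
    ultimately show "\<exists>P. eventually P (filtermap (slope \<gamma> t) (at t)) \<and> (\<forall>x y. P x \<and> P y \<longrightarrow> dist x y < e)"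
      by blast
  qed
  then obtain l where "filtermap (slope \<gamma> t) (at t) \<le> nhds l"
    using complete_uniform[of "UNIV :: real set"] complete_UNIV
    by (metis filtermap_bot_iff principal_UNIV top_greatest trivial_limit_at)
  then show ?thesis by (auto simp: filterlim_def)
qed

text \<open>
  A Rademacher theorem for curves in an arbitrary metric space. It is derived from the energy estimate
  alone, without differentiating real functions or integrating.
\<close>

theorem Lipschitz_metric_derivative_exists:
  assumes "C-lipschitz_on {a..b} \<gamma>"
  shows "negligible {t \<in> {a<..<b}. \<nexists>v. has_metric_deriv dist UNIV \<gamma> t v}"
proof (rule negligible_subset)
  show "negligible (\<Union>n. osc \<gamma> (1 / real (Suc n)) \<inter> {a<..<b})"
    using negligible_osc[OF assms] by (intro negligible_countable_Union) auto
  show "{t \<in> {a<..<b}. \<nexists>v. has_metric_deriv dist UNIV \<gamma> t v}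
      \<subseteq> (\<Union>n. osc \<gamma> (1 / real (Suc n)) \<inter> {a<..<b})"
    using slope_converges[of _ \<gamma>] unfolding has_metric_deriv_def slope_def by blast
qed

section \<open>Curves that are Lipschitz off finitely many points\<close>

lemma is_interval_Icc_subset:
  fixes I :: "real set"
  assumes "is_interval I" "u \<in> I" "v \<in> I"
  shows "{u..v} \<subseteq> I"
  using assms unfolding is_interval_1 subset_iff atLeastAtMost_iff by blast

text \<open>
  Lipschitz bounds on two adjacent intervals combine to one on their union, so a bisection argument
  passes from local bounds to the compact interval.
\<close>

lemma loc_lipschitz_imp_lipschitz_on:
  assumes "loc_lipschitz dist I \<gamma>" "{u..v} \<subseteq> I"
  shows "\<exists>C. C-lipschitz_on {u..v} \<gamma>"
proof (cases "u \<le> v")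
  case True
  define P where "P p q \<longleftrightarrow> (\<exists>C\<ge>0. \<forall>r\<in>{p..q} \<inter> {u..v}. \<forall>s\<in>{p..q} \<inter> {u..v}. dist (\<gamma> r) (\<gamma> s) \<le> C * \<bar>r - s\<bar>)"
    for p q
  have "P u v"
    using True
  proof (induction rule: Bolzano)
    case (trans p q r)
    obtain C where C: "0 \<le> C" "\<And>x y. x \<in> {p..q} \<inter> {u..v} \<Longrightarrow> y \<in> {p..q} \<inter> {u..v} \<Longrightarrow> dist (\<gamma> x) (\<gamma> y) \<le> C * \<bar>x - y\<bar>"
      using trans(1) by (auto simp: P_def)
    obtain D where D: "0 \<le> D" "\<And>x y. x \<in> {q..r} \<inter> {u..v} \<Longrightarrow> y \<in> {q..r} \<inter> {u..v} \<Longrightarrow> dist (\<gamma> x) (\<gamma> y) \<le> D * \<bar>x - y\<bar>"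
      using trans(2) by (auto simp: P_def)
    have CD: "C * z \<le> max C D * z" "D * z \<le> max C D * z" if "0 \<le> z" for z
      using that by (auto intro: mult_right_mono)
    have aux: "dist (\<gamma> x) (\<gamma> y) \<le> max C D * \<bar>x - y\<bar>"
      if "x \<in> {p..r} \<inter> {u..v}" "y \<in> {p..r} \<inter> {u..v}" "x \<le> y" for x y
    proof -
      consider "y \<le> q" | "q \<le> x" | "x \<le> q" "q \<le> y" by linarith
      then show ?thesis
      proof cases
        case 1
        then show ?thesis using C(2)[of x y] that CD[of "\<bar>x - y\<bar>"] by force
      next
        case 2
        then show ?thesis using D(2)[of x y] that CD[of "\<bar>x - y\<bar>"] by force
      next
        case 3
        then have "dist (\<gamma> x) (\<gamma> q) \<le> C * \<bar>x - q\<bar>" "dist (\<gamma> q) (\<gamma> y) \<le> D * \<bar>q - y\<bar>"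
          using C(2)[of x q] D(2)[of q y] that by auto
        then have "dist (\<gamma> x) (\<gamma> q) \<le> max C D * \<bar>x - q\<bar>" "dist (\<gamma> q) (\<gamma> y) \<le> max C D * \<bar>q - y\<bar>"
          using CD[of "\<bar>x - q\<bar>"] CD[of "\<bar>q - y\<bar>"] by linarith+
        then have "dist (\<gamma> x) (\<gamma> y) \<le> max C D * \<bar>x - q\<bar> + max C D * \<bar>q - y\<bar>"
          using dist_triangle[of "\<gamma> x" "\<gamma> y" "\<gamma> q"] by linarith
        also have "\<dots> = max C D * \<bar>x - y\<bar>"
          using 3 by (simp add: algebra_simps)
        finally show ?thesis .
      qed
    qed
    have "dist (\<gamma> x) (\<gamma> y) \<le> max C D * \<bar>x - y\<bar>"
      if "x \<in> {p..r} \<inter> {u..v}" "y \<in> {p..r} \<inter> {u..v}" for x y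
      using aux[of x y] aux[of y x] that by (cases "x \<le> y") (auto simp: dist_commute abs_minus_commute)
    then show ?case unfolding P_def using C(1) by (intro exI[of _ "max C D"]) auto
  next
    case (local x)
    then have "x \<in> I" using assms by auto
    then obtain e L where e: "0 < e" "\<forall>r\<in>I \<inter> ball x e. \<forall>s\<in>I \<inter> ball x e. dist (\<gamma> r) (\<gamma> s) \<le> L * \<bar>r - s\<bar>"
      using assms(1) unfolding loc_lipschitz_def by blast
    have "P p q" if "p \<le> x" "x \<le> q" "q - p < e" for p q
      unfolding P_def
    proof (intro exI[of _ "\<bar>L\<bar>"] conjI ballI)
      fix r s assume rs: "r \<in> {p..q} \<inter> {u..v}" "s \<in> {p..q} \<inter> {u..v}"
      then have "r \<in> I \<inter> ball x e" "s \<in> I \<inter> ball x e"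
        using assms(2) that by (auto simp: dist_real_def)
      then have "dist (\<gamma> r) (\<gamma> s) \<le> L * \<bar>r - s\<bar>" using e by blast
      also have "\<dots> \<le> \<bar>L\<bar> * \<bar>r - s\<bar>" by (intro mult_right_mono) auto
      finally show "dist (\<gamma> r) (\<gamma> s) \<le> \<bar>L\<bar> * \<bar>r - s\<bar>" .
    qed auto
    then show ?case using e(1) by blast
  qed
  then show ?thesis
    unfolding P_def lipschitz_on_def by (auto simp: dist_real_def)
qed (auto simp: lipschitz_on_def)

text \<open>
  This common generalisation of locally Lipschitz curves, piecewise locally Lipschitz curves and
  Lipschitz curves on compact intervals replaces the ordered breakpoints by a finite exceptional set,
  which is easier to restrict to subintervals and to do induction on.
\<close>

definition almost_lipschitz :: "real set \<Rightarrow> (real \<Rightarrow> 'a::metric_space) \<Rightarrow> bool" where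
  "almost_lipschitz I \<gamma> \<longleftrightarrow> continuous_on I \<gamma> \<and>
     (\<exists>B. finite B \<and> (\<forall>u v. {u..v} \<subseteq> interior I - B \<longrightarrow> (\<exists>C. C-lipschitz_on {u..v} \<gamma>)))"

lemma loc_lipschitz_imp_continuous_on:
  assumes "loc_lipschitz dist I \<gamma>"
  shows "continuous_on I \<gamma>"
  unfolding continuous_on_def
proof
  fix t assume "t \<in> I"
  then obtain e L where e: "0 < e" "\<forall>r\<in>I \<inter> ball t e. \<forall>s\<in>I \<inter> ball t e. dist (\<gamma> r) (\<gamma> s) \<le> L * \<bar>r - s\<bar>"
    using assms unfolding loc_lipschitz_def by blast
  have "((\<lambda>s. dist (\<gamma> s) (\<gamma> t)) \<longlongrightarrow> 0) (at t within I)"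
  proof (rule tendsto_sandwich[of "\<lambda>_. 0" _ _ "\<lambda>s. L * \<bar>s - t\<bar>"])
    show "\<forall>\<^sub>F s in at t within I. dist (\<gamma> s) (\<gamma> t) \<le> L * \<bar>s - t\<bar>"
      unfolding eventually_at using e \<open>t \<in> I\<close> by (auto simp: dist_commute intro!: exI[of _ e])
    show "((\<lambda>s. L * \<bar>s - t\<bar>) \<longlongrightarrow> 0) (at t within I)"
      by (rule tendsto_eq_intros refl | simp)+
  qed auto
  then show "(\<gamma> \<longlongrightarrow> \<gamma> t) (at t within I)"
    by (subst tendsto_dist_iff)
qed

lemma loc_lipschitz_imp_almost_lipschitz:
  assumes "loc_lipschitz dist I \<gamma>"
  shows "almost_lipschitz I \<gamma>"
  unfolding almost_lipschitz_def
proof (intro conjI exI[of _ "{}"] allI impI)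
  show "\<exists>C. C-lipschitz_on {u..v} \<gamma>" if "{u..v} \<subseteq> interior I - {}" for u v
    using loc_lipschitz_imp_lipschitz_on[OF assms, of u v] that interior_subset[of I] by simp
qed (use loc_lipschitz_imp_continuous_on[OF assms] in auto)

lemma lipschitz_on_imp_almost_lipschitz:
  assumes "C-lipschitz_on {a..b} \<gamma>"
  shows "almost_lipschitz {a..b} \<gamma>"
  unfolding almost_lipschitz_def
proof (intro conjI exI[of _ "{}"] allI impI)
  show "\<exists>C. C-lipschitz_on {u..v} \<gamma>" if "{u..v} \<subseteq> interior {a..b} - {}" for u v
    using lipschitz_on_subset[OF assms, of "{u..v}"] that interior_subset[of "{a..b}"] by blast
qed (use lipschitz_on_continuous_on[OF assms] in auto)

lemma piecewise_imp_almost_lipschitz: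
  assumes "piecewise_loc_lipschitz I \<gamma>"
  shows "almost_lipschitz I \<gamma>"
proof -
  obtain n and t :: "nat \<Rightarrow> ereal" where t: "t 0 = Inf (ereal ` I)" "t n = Sup (ereal ` I)"
      "\<And>i. i < n \<Longrightarrow> t i < t (Suc i)"
      "\<And>i. i < n \<Longrightarrow> loc_lipschitz dist (I \<inter> {s. t i < ereal s \<and> ereal s < t (Suc i)}) \<gamma>"
    and cont: "continuous_on I \<gamma>"
    using assms unfolding piecewise_loc_lipschitz_def by blast
  define B where "B = (\<lambda>i. real_of_ereal (t i)) ` {..n}"
  have "\<exists>C. C-lipschitz_on {u..v} \<gamma>" if uv: "{u..v} \<subseteq> interior I - B" for u v
  proof (cases "u \<le> v")
    case True
    have uI: "u \<in> interior I" "{u..v} \<subseteq> I" using uv True interior_subset by (auto simp: subset_iff)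
    then obtain e where e: "0 < e" "cball u e \<subseteq> I"
      unfolding mem_interior_cball by blast
    have "u - e \<in> I" using e by (auto simp: subset_iff dist_real_def)
    then have "t 0 \<le> ereal (u - e)" unfolding t(1) by (intro Inf_lower) auto
    also have "\<dots> < ereal u" using e by simp
    finally have t0: "t 0 < ereal u" .
    have "v \<in> I" using uI True by auto
    then have tn: "ereal v \<le> t n" unfolding t(2) by (intro Sup_upper) auto
    (* The piece containing u is the last one that starts before u. *)
    have "\<exists>i<n. t i < ereal u \<and> \<not> t (Suc i) < ereal u"
    proof (rule ccontr)
      assume *: "\<not> ?thesis"
      have "i \<le> n \<Longrightarrow> t i < ereal u" for i
        by (induction i) (use t0 * in auto)
      then have "t n < ereal u" by simp
      moreover have "ereal u \<le> ereal v" using True by simp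
      ultimately show False using tn by (meson leD order.trans)
    qed
    then obtain i where i: "i < n" "t i < ereal u" "ereal u \<le> t (Suc i)" by (auto simp: not_less)
    have "ereal v < t (Suc i)"
    proof (rule ccontr)
      assume "\<not> ?thesis"
      then obtain r where r: "t (Suc i) = ereal r" "u \<le> r" "r \<le> v"
        using i by (cases "t (Suc i)") auto
      then have "r \<in> B" unfolding B_def using i by (auto intro!: image_eqI[of _ _ "Suc i"])
      then show False using r uv by auto
    qed
    then have "t i < ereal s \<and> ereal s < t (Suc i)" if "s \<in> {u..v}" for s
      using that i(2) less_le_trans[of "t i" "ereal u" "ereal s"] le_less_trans[of "ereal s" "ereal v" "t (Suc i)"]
      by auto
    then have "{u..v} \<subseteq> I \<inter> {s. t i < ereal s \<and> ereal s < t (Suc i)}"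
      using uI by blast
    then show ?thesis using loc_lipschitz_imp_lipschitz_on[OF t(4)[OF i(1)]] by blast
  qed (auto simp: lipschitz_on_def)
  moreover have "finite B" by (simp add: B_def)
  ultimately show ?thesis unfolding almost_lipschitz_def using cont by blast
qed

text \<open>
  At interior points the metric derivative does not depend on the interval, so almost everywhere it
  can be computed relative to the whole line.
\<close>

lemma AE_interior_interval:
  fixes I :: "real set"
  assumes "is_interval I"
  shows "AE t in lebesgue. t \<in> I \<longrightarrow> t \<in> interior I"
proof -
  have "negligible (frontier I)"
    using assms by (simp add: negligible_convex_frontier is_interval_convex)
  then have "AE t in lebesgue. t \<notin> frontier I"
    unfolding negligible_iff_null_sets by (rule AE_not_in)
  then show ?thesis
    by eventually_elim (use closure_subset[of I] in \<open>auto simp: frontier_def\<close>)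
qed

text \<open>
  Countably many compact intervals with rational endpoints, on each of which the curve is Lipschitz,
  cover the interior of \<open>I\<close> up to the finite exceptional set.
\<close>

lemma AE_has_metric_deriv:
  assumes I: "is_interval I" and lip: "almost_lipschitz I \<gamma>"
  shows "AE t in lebesgue. t \<in> I \<longrightarrow> t \<in> interior I \<and> (\<exists>v. has_metric_deriv dist UNIV \<gamma> t v)"
proof -
  obtain B where B: "finite B" "\<And>u v. {u..v} \<subseteq> interior I - B \<Longrightarrow> \<exists>C. C-lipschitz_on {u..v} \<gamma>"
    using lip unfolding almost_lipschitz_def by blast
  define Q where "Q = {(p, q). p \<in> \<rat> \<and> q \<in> \<rat> \<and> {p..q} \<subseteq> interior I - B}"
  define N where "N p q = {t \<in> {p<..<q}. \<nexists>v. has_metric_deriv dist UNIV \<gamma> t v}" for p q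
  have "countable Q"
    by (rule countable_subset[of _ "\<rat> \<times> \<rat>"]) (auto simp: Q_def countable_rat)
  have "negligible (N p q)" if "(p, q) \<in> Q" for p q
    using that B(2)[of p q] Lipschitz_metric_derivative_exists[of _ p q \<gamma>] by (auto simp: Q_def N_def)
  then have "negligible (\<Union>(p, q)\<in>Q. N p q)"
    using \<open>countable Q\<close> by (intro negligible_countable_Union) auto
  then have "negligible (B \<union> (\<Union>(p, q)\<in>Q. N p q))"
    using B(1) by (simp add: negligible_finite)
  then have "AE t in lebesgue. t \<notin> B \<union> (\<Union>(p, q)\<in>Q. N p q)"
    unfolding negligible_iff_null_sets by (rule AE_not_in)
  with AE_interior_interval[OF I] show ?thesis
  proof eventually_elim
    case (elim t)
    show ?case
    proof (intro impI conjI)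
      assume "t \<in> I"
      then show t: "t \<in> interior I" using elim by blast
      have "open (interior I - B)" using B(1) by (simp add: finite_imp_closed open_Diff)
      then obtain e where e: "0 < e" "ball t e \<subseteq> interior I - B"
        using t elim(2) open_contains_ball by blast
      obtain p where p: "p \<in> \<rat>" "t - e < p" "p < t" using Rats_dense_in_real[of "t - e" t] e by auto
      obtain q where q: "q \<in> \<rat>" "t < q" "q < t + e" using Rats_dense_in_real[of t "t + e"] e by auto
      have "{p..q} \<subseteq> ball t e" using p q by (auto simp: dist_real_def)
      then have "(p, q) \<in> Q" using p q e by (auto simp: Q_def)
      then have "t \<notin> N p q" using elim(2) by auto
      then show "\<exists>v. has_metric_deriv dist UNIV \<gamma> t v" using p q by (auto simp: N_def)
    qed
  qed
qed

lemma has_metric_deriv_imp_metric_deriv: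
  "has_metric_deriv \<delta> UNIV \<gamma> t v \<Longrightarrow> metric_deriv \<delta> UNIV \<gamma> t = v"
  unfolding has_metric_deriv_def metric_deriv_def by (intro tendsto_Lim) auto

lemma metric_deriv_interior: "t \<in> interior I \<Longrightarrow> metric_deriv \<delta> I \<gamma> t = metric_deriv \<delta> UNIV \<gamma> t"
  using at_within_interior[of t I] by (simp add: metric_deriv_def)

lemma has_metric_deriv_interior:
  "t \<in> interior I \<Longrightarrow> has_metric_deriv \<delta> I \<gamma> t v \<longleftrightarrow> has_metric_deriv \<delta> UNIV \<gamma> t v"
  using at_within_interior[of t I] by (simp add: has_metric_deriv_def)

section \<open>Weighted length as the integral of a measurable speed\<close>

definition weighted_speed :: "('a::metric_space \<Rightarrow> real) \<Rightarrow> (real \<Rightarrow> 'a) \<Rightarrow> real \<Rightarrow> ennreal" where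
  "weighted_speed K \<gamma> t = ennreal (K (\<gamma> t) * metric_deriv dist UNIV \<gamma> t)"

text \<open>
  Replacing the metric derivative relative to \<open>I\<close> by the one relative to the whole line makes the
  integrand independent of \<open>I\<close>, so that weighted lengths over different intervals can be compared and
  added.
\<close>

lemma weighted_length_eq:
  assumes "is_interval I"
  shows "weighted_length K I \<gamma> = (\<integral>\<^sup>+t\<in>I. weighted_speed K \<gamma> t \<partial>lebesgue)"
  unfolding weighted_length_def
proof (rule nn_integral_cong_AE)
  show "AE t in lebesgue. ennreal (K (\<gamma> t) * metric_deriv dist I \<gamma> t) * indicator I t =
      weighted_speed K \<gamma> t * indicator I t"
    using AE_interior_interval[OF assms]
  proof eventually_elim
    case (elim t)
    then show ?case
      using metric_deriv_interior[of t I dist \<gamma>] by (cases "t \<in> I") (simp_all add: weighted_speed_def)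
  qed
qed

text \<open>
  Difference quotients with step \<open>1 / (n + 1)\<close>, set to zero where the second point leaves \<open>I\<close>. They
  approximate the metric derivative by Borel functions, for several choices of \<open>\<delta>\<close>: a weighted
  distance for measurability, a real increment for lower bounds and \<open>d\<^sub>K\<close> for the length formula.
\<close>

definition forward_quotient ::
    "('a \<Rightarrow> 'a \<Rightarrow> real) \<Rightarrow> real set \<Rightarrow> (real \<Rightarrow> 'a) \<Rightarrow> nat \<Rightarrow> real \<Rightarrow> real" where
  "forward_quotient \<delta> I \<gamma> n t =
     (if t \<in> I \<inter> {t. t + 1 / real (Suc n) \<in> I} then \<delta> (\<gamma> t) (\<gamma> (t + 1 / real (Suc n))) * real (Suc n) else 0)"

lemma forward_quotient_tendsto:
  assumes "has_metric_deriv \<delta> UNIV \<gamma> t v" "t \<in> interior I"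
  shows "(\<lambda>n. forward_quotient \<delta> I \<gamma> n t) \<longlonglongrightarrow> v"
proof -
  have lim: "(\<lambda>n. t + 1 / real (Suc n)) \<longlonglongrightarrow> t"
    using tendsto_add[OF tendsto_const[of t] LIMSEQ_inverse_real_of_nat] by (simp add: inverse_eq_divide)
  then have "filterlim (\<lambda>n. t + 1 / real (Suc n)) (at t) sequentially"
    by (auto simp: filterlim_at)
  then have "(\<lambda>n. \<delta> (\<gamma> t) (\<gamma> (t + 1 / real (Suc n))) / \<bar>t - (t + 1 / real (Suc n))\<bar>) \<longlonglongrightarrow> v"
    using assms(1) unfolding has_metric_deriv_def by (rule filterlim_compose[rotated])
  moreover have "\<forall>\<^sub>F n in sequentially. t + 1 / real (Suc n) \<in> interior I"
    using lim assms(2) by (intro topological_tendstoD[OF lim]) auto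
  then have "\<forall>\<^sub>F n in sequentially. \<delta> (\<gamma> t) (\<gamma> (t + 1 / real (Suc n))) / \<bar>t - (t + 1 / real (Suc n))\<bar> =
      forward_quotient \<delta> I \<gamma> n t"
    by eventually_elim (use assms(2) interior_subset[of I] in \<open>auto simp: forward_quotient_def\<close>)
  ultimately show ?thesis by (rule Lim_transform_eventually)
qed

lemma forward_quotient_measurable:
  assumes I: "is_interval I" and cont: "\<And>h. continuous_on (I \<inter> {t. t + h \<in> I}) (\<lambda>t. \<delta> (\<gamma> t) (\<gamma> (t + h)))"
  shows "forward_quotient \<delta> I \<gamma> n \<in> borel_measurable borel"
proof -
  have "is_interval {t. t + 1 / real (Suc n) \<in> I}"
    using I unfolding is_interval_1 by (metis add_right_mono mem_Collect_eq)
  then have "I \<inter> {t. t + 1 / real (Suc n) \<in> I} \<in> sets borel"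
    using I by (intro sets.Int real_interval_borel_measurable)
  then show ?thesis
    unfolding forward_quotient_def
    by (intro borel_measurable_continuous_on_if continuous_on_mult cont) (auto intro!: continuous_intros)
qed

lemma continuous_on_shift:
  assumes "continuous_on I \<gamma>"
  shows "continuous_on (I \<inter> {t. t + h \<in> I}) (\<lambda>t. \<gamma> (t + h :: real))"
  by (intro continuous_on_compose2[OF assms] continuous_intros) auto

text \<open>
  Completeness of Lebesgue measure: changing a function on a null set preserves measurability.
\<close>

lemma borel_measurable_lebesgue_cong_AE:
  fixes f g :: "real \<Rightarrow> 'b::topological_space"
  assumes f: "f \<in> borel_measurable lebesgue" and ae: "AE t in lebesgue. f t = g t"
  shows "g \<in> borel_measurable lebesgue"
proof (rule measurableI)
  fix A :: "'b set" assume A: "A \<in> sets borel"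
  show "g -` A \<inter> space lebesgue \<in> sets lebesgue"
  proof (rule completion.in_sets_AE)
    show "f -` A \<inter> space lebesgue \<in> sets lebesgue" using f A by (rule measurable_sets)
    show "AE t in lebesgue. (t \<in> f -` A \<inter> space lebesgue) = (t \<in> g -` A \<inter> space lebesgue)"
      using ae by eventually_elim auto
  qed auto
qed auto

text \<open>
  The weighted speed agrees almost everywhere with the lower limit of Borel difference quotients.
\<close>

lemma weighted_speed_measurable:
  fixes \<gamma> :: "real \<Rightarrow> 'a::metric_space"
  assumes I: "is_interval I" and lip: "almost_lipschitz I \<gamma>" and K: "continuous_on UNIV K"
  shows "(\<lambda>t. weighted_speed K \<gamma> t * indicator I t) \<in> borel_measurable lebesgue"
proof -
  have cont: "continuous_on I \<gamma>" using lip by (simp add: almost_lipschitz_def)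
  have "continuous_on (I \<inter> {t. t + h \<in> I}) (\<lambda>t. K (\<gamma> t) * dist (\<gamma> t) (\<gamma> (t + h)))" for h
    using K cont
    by (intro continuous_intros continuous_on_shift continuous_on_compose2[OF K])
       (auto elim: continuous_on_subset)
  then have "forward_quotient (\<lambda>x y. K x * dist x y) I \<gamma> n \<in> borel_measurable borel" for n
    using I by (intro forward_quotient_measurable) auto
  then have "(\<lambda>t. liminf (\<lambda>n. ennreal (forward_quotient (\<lambda>x y. K x * dist x y) I \<gamma> n t)) * indicator I t)
      \<in> borel_measurable borel"
    using real_interval_borel_measurable[OF I] by measurable
  then have "(\<lambda>t. liminf (\<lambda>n. ennreal (forward_quotient (\<lambda>x y. K x * dist x y) I \<gamma> n t)) * indicator I t)
      \<in> borel_measurable lebesgue"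
    by (simp add: measurable_completion)
  then show ?thesis
  proof (rule borel_measurable_lebesgue_cong_AE)
    show "AE t in lebesgue. liminf (\<lambda>n. ennreal (forward_quotient (\<lambda>x y. K x * dist x y) I \<gamma> n t)) * indicator I t =
        weighted_speed K \<gamma> t * indicator I t"
      using AE_has_metric_deriv[OF I lip]
    proof eventually_elim
      case (elim t)
      show ?case
      proof (cases "t \<in> I")
        case True
        then obtain v where v: "has_metric_deriv dist UNIV \<gamma> t v" and t: "t \<in> interior I" using elim by blast
        have "has_metric_deriv (\<lambda>x y. K x * dist x y) UNIV \<gamma> t (K (\<gamma> t) * v)"
          using tendsto_mult[OF tendsto_const[of "K (\<gamma> t)"] v[unfolded has_metric_deriv_def]]
          unfolding has_metric_deriv_def by simp
        from forward_quotient_tendsto[OF this t]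
        have "(\<lambda>n. ennreal (forward_quotient (\<lambda>x y. K x * dist x y) I \<gamma> n t)) \<longlonglongrightarrow> ennreal (K (\<gamma> t) * v)"
          by (rule tendsto_ennrealI)
        then show ?thesis
          using has_metric_deriv_imp_metric_deriv[OF v]
          by (simp add: weighted_speed_def lim_imp_Liminf)
      qed auto
    qed
  qed
qed

lemma weighted_speed_measurable_subset:
  assumes "is_interval I" "almost_lipschitz I \<gamma>" "continuous_on UNIV K" "S \<subseteq> I" "S \<in> sets lebesgue"
  shows "(\<lambda>t. weighted_speed K \<gamma> t * indicator S t) \<in> borel_measurable lebesgue"
proof -
  have "(\<lambda>t. (weighted_speed K \<gamma> t * indicator I t) * indicator S t) \<in> borel_measurable lebesgue"
    using weighted_speed_measurable[OF assms(1-3)] assms(5) by measurable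
  also have "(\<lambda>t. (weighted_speed K \<gamma> t * indicator I t) * indicator S t) =
      (\<lambda>t. weighted_speed K \<gamma> t * indicator S t)"
    using assms(4) by (auto simp: indicator_def fun_eq_iff)
  finally show ?thesis .
qed

lemma weighted_length_split:
  assumes "is_interval I" "almost_lipschitz I \<gamma>" "continuous_on UNIV K" "{u..v} \<subseteq> I" "u \<le> w" "w \<le> v"
  shows "weighted_length K {u..v} \<gamma> = weighted_length K {u..w} \<gamma> + weighted_length K {w..v} \<gamma>"
proof -
  let ?f = "\<lambda>S t. weighted_speed K \<gamma> t * indicator S t"
  have "AE t in lebesgue. t \<notin> {w :: real}"
    by (rule AE_not_in) (simp flip: negligible_iff_null_sets)
  then have "AE t in lebesgue. ?f {u..v} t = ?f {u..w} t + ?f {w..v} t"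
    by eventually_elim (use assms(5,6) in \<open>auto simp: indicator_def\<close>)
  then have "(\<integral>\<^sup>+t. ?f {u..v} t \<partial>lebesgue) = (\<integral>\<^sup>+t. ?f {u..w} t + ?f {w..v} t \<partial>lebesgue)"
    by (rule nn_integral_cong_AE)
  also have "\<dots> = (\<integral>\<^sup>+t. ?f {u..w} t \<partial>lebesgue) + (\<integral>\<^sup>+t. ?f {w..v} t \<partial>lebesgue)"
    using assms by (intro nn_integral_add weighted_speed_measurable_subset[OF assms(1-3)]) auto
  finally show ?thesis by (simp add: weighted_length_eq)
qed

lemma weighted_length_mono:
  assumes "S \<subseteq> I" "is_interval S" "is_interval I"
  shows "weighted_length K S \<gamma> \<le> weighted_length K I \<gamma>"
  using assms by (auto simp: weighted_length_eq indicator_def intro!: nn_integral_mono)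

section \<open>The cost of Lipschitz connections\<close>

lemma nn_integral_lebesgue_real_affine:
  fixes f :: "real \<Rightarrow> ennreal"
  assumes f: "f \<in> borel_measurable lebesgue" and c: "c \<noteq> 0"
  shows "(\<integral>\<^sup>+x. f x \<partial>lebesgue) = ennreal \<bar>c\<bar> * (\<integral>\<^sup>+x. f (t + c * x) \<partial>lebesgue)"
proof -
  have m: "(\<lambda>x. t + c * x) \<in> lebesgue \<rightarrow>\<^sub>M lebesgue"
    using lebesgue_affine_measurable[where c = "\<lambda>x::real. c"] c by simp
  have fm: "(\<lambda>x. f (t + c * x)) \<in> borel_measurable lebesgue"
    using f m by (rule measurable_compose[rotated])
  show ?thesis
    by (subst lebesgue_real_affine[OF c, of t])
       (use f m fm in \<open>simp add: nn_integral_density nn_integral_distr nn_integral_cmult\<close>)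
qed

lemma metric_deriv_shift: "metric_deriv \<delta> UNIV (\<lambda>r. \<gamma> (r - d)) t = metric_deriv \<delta> UNIV \<gamma> (t - d)"
proof -
  have "(at (t - d)) = filtermap (\<lambda>r. r - d) (at t)" by (rule filtermap_at_shift[symmetric])
  then show ?thesis
    unfolding metric_deriv_def t2_space_class.Lim_def by (simp add: filterlim_filtermap)
qed

lemma metric_deriv_reflect: "metric_deriv \<delta> UNIV (\<lambda>r. \<gamma> (- r)) t = metric_deriv \<delta> UNIV \<gamma> (- t)"
proof -
  have "(at (- t)) = filtermap (\<lambda>r. - r) (at t)" by (rule filtermap_at_minus[symmetric])
  then show ?thesis
    unfolding metric_deriv_def t2_space_class.Lim_def by (simp add: filterlim_filtermap abs_minus_commute)
qed

lemma weighted_length_shift: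
  assumes K: "continuous_on UNIV K" and lip: "C-lipschitz_on {a..b} \<gamma>"
  shows "weighted_length K {a + d..b + d} (\<lambda>r. \<gamma> (r - d)) = weighted_length K {a..b} \<gamma>"
proof -
  let ?f = "\<lambda>t. weighted_speed K \<gamma> t * indicator {a..b} t"
  have m: "?f \<in> borel_measurable lebesgue"
    using lipschitz_on_imp_almost_lipschitz[OF lip] K by (intro weighted_speed_measurable) auto
  have "(\<integral>\<^sup>+t. ?f t \<partial>lebesgue) = (\<integral>\<^sup>+t. ?f (- d + 1 * t) \<partial>lebesgue)"
    by (subst nn_integral_lebesgue_real_affine[OF m, of 1 "- d"]) simp_all
  also have "\<dots> = (\<integral>\<^sup>+t\<in>{a + d..b + d}. weighted_speed K (\<lambda>r. \<gamma> (r - d)) t \<partial>lebesgue)"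
    by (intro nn_integral_cong)
       (auto simp: weighted_speed_def metric_deriv_shift indicator_def)
  finally show ?thesis by (simp add: weighted_length_eq)
qed

lemma weighted_length_reflect:
  assumes K: "continuous_on UNIV K" and lip: "C-lipschitz_on {a..b} \<gamma>"
  shows "weighted_length K {- b..- a} (\<lambda>r. \<gamma> (- r)) = weighted_length K {a..b} \<gamma>"
proof -
  let ?f = "\<lambda>t. weighted_speed K \<gamma> t * indicator {a..b} t"
  have m: "?f \<in> borel_measurable lebesgue"
    using lipschitz_on_imp_almost_lipschitz[OF lip] K by (intro weighted_speed_measurable) auto
  have "(\<integral>\<^sup>+t. ?f t \<partial>lebesgue) = (\<integral>\<^sup>+t. ?f (0 + -1 * t) \<partial>lebesgue)"
    by (subst nn_integral_lebesgue_real_affine[OF m, of "-1" 0]) simp_all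
  also have "\<dots> = (\<integral>\<^sup>+t\<in>{- b..- a}. weighted_speed K (\<lambda>r. \<gamma> (- r)) t \<partial>lebesgue)"
    by (intro nn_integral_cong)
       (auto simp: weighted_speed_def metric_deriv_reflect indicator_def)
  finally show ?thesis by (simp add: weighted_length_eq)
qed

lemma weighted_length_cong:
  assumes "\<And>t. t \<in> I \<Longrightarrow> \<gamma> t = \<gamma>' t"
  shows "weighted_length K I \<gamma> = weighted_length K I \<gamma>'"
proof -
  have "metric_deriv dist I \<gamma> t = metric_deriv dist I \<gamma>' t" if "t \<in> I" for t
  proof -
    have "((\<lambda>s. dist (\<gamma> t) (\<gamma> s) / \<bar>t - s\<bar>) \<longlongrightarrow> l) (at t within I) \<longleftrightarrow>
        ((\<lambda>s. dist (\<gamma>' t) (\<gamma>' s) / \<bar>t - s\<bar>) \<longlongrightarrow> l) (at t within I)" for l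
      using that assms by (intro tendsto_cong) (auto simp: eventually_at_filter)
    then show ?thesis unfolding metric_deriv_def t2_space_class.Lim_def by simp
  qed
  then show ?thesis
    unfolding weighted_length_def using assms by (intro nn_integral_cong) (auto simp: indicator_def)
qed

definition lipschitz_connection :: "('a::metric_space \<Rightarrow> real) \<Rightarrow> 'a \<Rightarrow> 'a \<Rightarrow> ennreal \<Rightarrow> bool" where
  "lipschitz_connection K x y c \<longleftrightarrow>
     (\<exists>a b \<gamma>. a \<le> b \<and> (\<exists>C. C-lipschitz_on {a..b} \<gamma>) \<and> \<gamma> a = x \<and> \<gamma> b = y \<and> c = weighted_length K {a..b} \<gamma>)"

text \<open>
  The same infimum as in \<open>weighted_edist\<close>, taken only over Lipschitz curves on compact intervals. These
  are closed under reversal and concatenation, which makes the triangle inequality easy; curves with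
  infinite ends cannot be concatenated directly.
\<close>

definition lipschitz_cost :: "('a::metric_space \<Rightarrow> real) \<Rightarrow> 'a \<Rightarrow> 'a \<Rightarrow> ennreal" where
  "lipschitz_cost K x y = Inf {c. lipschitz_connection K x y c}"

text \<open>
  The second curve is translated so that it starts where the first one ends.
\<close>

lemma lipschitz_connection_join:
  assumes K: "continuous_on UNIV K"
    and "lipschitz_connection K x y c" "lipschitz_connection K y z c'"
  shows "lipschitz_connection K x z (c + c')"
proof -
  obtain a b \<gamma> C where 1: "a \<le> b" "C-lipschitz_on {a..b} \<gamma>" "\<gamma> a = x" "\<gamma> b = y"
      "c = weighted_length K {a..b} \<gamma>"
    using assms(2) unfolding lipschitz_connection_def by blast
  obtain a' b' \<gamma>' C' where 2: "a' \<le> b'" "C'-lipschitz_on {a'..b'} \<gamma>'" "\<gamma>' a' = y" "\<gamma>' b' = z"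
      "c' = weighted_length K {a'..b'} \<gamma>'"
    using assms(3) unfolding lipschitz_connection_def by blast
  (* The shift that moves the start of the second curve to the end of the first. *)
  define d where "d = b - a'"
  define \<gamma>2 where "\<gamma>2 r = \<gamma>' (r - d)" for r
  define \<beta> where "\<beta> r = (if r \<le> b then \<gamma> r else \<gamma>2 r)" for r
  have ends: "a' + d = b" "b \<le> b' + d" using 2(1) by (auto simp: d_def)
  have "weighted_length K {a' + d..b' + d} \<gamma>2 = c'"
    unfolding \<gamma>2_def using weighted_length_shift[OF K 2(2)] 2(5) by simp
  then have len2: "weighted_length K {b..b' + d} \<gamma>2 = c'" by (simp add: ends)
  have lip2: "C'-lipschitz_on {b..b' + d} \<gamma>2"
  proof (rule lipschitz_onI)
    show "dist (\<gamma>2 s) (\<gamma>2 t) \<le> C' * dist s t" if "s \<in> {b..b' + d}" "t \<in> {b..b' + d}" for s t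
      using lipschitz_onD[OF 2(2), of "s - d" "t - d"] that by (simp add: \<gamma>2_def d_def dist_real_def)
  qed (rule lipschitz_on_nonneg[OF 2(2)])
  have at_b: "\<gamma> b = \<gamma>2 b" using 1 2 by (simp add: \<gamma>2_def d_def)
  have lip: "(max C C')-lipschitz_on {a..b' + d} \<beta>"
    unfolding \<beta>_def using lipschitz_on_concat_max[OF 1(2) lip2 at_b] .
  have "weighted_length K {a..b' + d} \<beta> = weighted_length K {a..b} \<beta> + weighted_length K {b..b' + d} \<beta>"
    using lipschitz_on_imp_almost_lipschitz[OF lip] K 1(1) ends
    by (intro weighted_length_split[of "{a..b' + d}"]) auto
  also have "weighted_length K {a..b} \<beta> = weighted_length K {a..b} \<gamma>"
    by (rule weighted_length_cong) (auto simp: \<beta>_def)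
  also have "weighted_length K {b..b' + d} \<beta> = weighted_length K {b..b' + d} \<gamma>2"
    using at_b by (intro weighted_length_cong) (auto simp: \<beta>_def)
  finally have "c + c' = weighted_length K {a..b' + d} \<beta>" using 1 len2 by simp
  moreover have "\<beta> a = x" "\<beta> (b' + d) = z" "a \<le> b' + d"
    using 1 2 ends at_b by (auto simp: \<beta>_def \<gamma>2_def)
  ultimately show ?thesis unfolding lipschitz_connection_def using lip by blast
qed

lemma lipschitz_connection_reverse:
  assumes K: "continuous_on UNIV K" and "lipschitz_connection K x y c"
  shows "lipschitz_connection K y x c"
proof -
  obtain a b \<gamma> C where 1: "a \<le> b" "C-lipschitz_on {a..b} \<gamma>" "\<gamma> a = x" "\<gamma> b = y"
      "c = weighted_length K {a..b} \<gamma>"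
    using assms(2) unfolding lipschitz_connection_def by blast
  have "C-lipschitz_on {- b..- a} (\<lambda>r. \<gamma> (- r))"
  proof (rule lipschitz_onI)
    show "dist (\<gamma> (- s)) (\<gamma> (- t)) \<le> C * dist s t" if "s \<in> {- b..- a}" "t \<in> {- b..- a}" for s t
      using lipschitz_onD[OF 1(2), of "- s" "- t"] that by (simp add: dist_minus)
  qed (rule lipschitz_on_nonneg[OF 1(2)])
  then show ?thesis
    unfolding lipschitz_connection_def
    using 1 weighted_length_reflect[OF K 1(2)]
    by (intro exI[of _ "- b"] exI[of _ "- a"] exI[of _ "\<lambda>r. \<gamma> (- r)"]) auto
qed

lemma lipschitz_cost_lower: "lipschitz_connection K x y c \<Longrightarrow> lipschitz_cost K x y \<le> c"
  unfolding lipschitz_cost_def by (intro Inf_lower) simp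

lemma lipschitz_cost_near:
  assumes "lipschitz_cost K x y < \<infinity>" "0 < (e::real)"
  shows "\<exists>c. lipschitz_connection K x y c \<and> c < lipschitz_cost K x y + ennreal e"
proof -
  have "lipschitz_cost K x y < lipschitz_cost K x y + ennreal e"
    using assms by (cases "lipschitz_cost K x y") (auto simp: ennreal_lessI simp flip: ennreal_plus)
  then show ?thesis
    unfolding lipschitz_cost_def[of K x y] Inf_less_iff by auto
qed

lemma lipschitz_cost_triangle:
  assumes K: "continuous_on UNIV K"
  shows "lipschitz_cost K x z \<le> lipschitz_cost K x y + lipschitz_cost K y z"
proof (rule ennreal_le_epsilon)
  fix e :: real assume fin: "lipschitz_cost K x y + lipschitz_cost K y z < top" and e: "0 < e"
  obtain c where c: "lipschitz_connection K x y c" "c < lipschitz_cost K x y + ennreal (e / 2)"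
    using lipschitz_cost_near[of K x y "e / 2"] fin e by auto
  obtain c' where c': "lipschitz_connection K y z c'" "c' < lipschitz_cost K y z + ennreal (e / 2)"
    using lipschitz_cost_near[of K y z "e / 2"] fin e by auto
  have "lipschitz_cost K x z \<le> c + c'"
    using lipschitz_connection_join[OF K c(1) c'(1)] by (rule lipschitz_cost_lower)
  also have "\<dots> \<le> (lipschitz_cost K x y + ennreal (e / 2)) + (lipschitz_cost K y z + ennreal (e / 2))"
    using c c' by (intro add_mono) auto
  also have "\<dots> = lipschitz_cost K x y + lipschitz_cost K y z + ennreal e"
    using e by (simp add: ac_simps flip: ennreal_plus)
  finally show "lipschitz_cost K x z \<le> lipschitz_cost K x y + lipschitz_cost K y z + ennreal e" .
qed

lemma lipschitz_cost_commute:
  assumes K: "continuous_on UNIV K"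
  shows "lipschitz_cost K x y = lipschitz_cost K y x"
proof -
  have "{c. lipschitz_connection K x y c} = {c. lipschitz_connection K y x c}"
    using lipschitz_connection_reverse[OF K] by blast
  then show ?thesis by (simp add: lipschitz_cost_def)
qed

section \<open>Geodesics in proper length spaces\<close>

lemma path_from_to_is_interval:
  assumes "path_from_to I \<gamma> x y"
  shows "is_interval I"
proof -
  obtain a b :: ereal where "I = {t. a \<le> ereal t \<and> ereal t \<le> b}"
    using assms unfolding path_from_to_def by blast
  moreover have "a \<le> ereal r \<and> ereal r \<le> b"
    if "a \<le> ereal p" "p \<le> r" "r \<le> q" "ereal q \<le> b" for p q r
    using that order.trans[of a "ereal p" "ereal r"] order.trans[of "ereal r" "ereal q" b] by simp
  ultimately show ?thesis unfolding is_interval_1 by blast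
qed

text \<open>
  Covers finite and infinite ends alike, so that a path with infinite ends can be cut off arbitrarily
  close to its limits.
\<close>

lemma path_near_start:
  assumes path: "path_from_to I \<gamma> x y" and "t \<in> I" "0 < (e::real)"
  shows "\<exists>s\<in>I. s \<le> t \<and> dist (\<gamma> s) x < e"
proof -
  obtain a b :: ereal where I: "I = {t. a \<le> ereal t \<and> ereal t \<le> b}"
      and start: "if a = - \<infinity> then (\<gamma> \<longlongrightarrow> x) at_bot else \<gamma> (real_of_ereal a) = x"
    using path unfolding path_from_to_def by blast
  show ?thesis
  proof (cases a)
    case (real r)
    then have "\<gamma> r = x" "r \<le> t" using start assms(2) I by auto
    moreover have "r \<in> I"
      using assms(2) I real \<open>r \<le> t\<close> order.trans[of "ereal r" "ereal t" b] by simp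
    ultimately show ?thesis using \<open>0 < e\<close> by (intro bexI[of _ r]) auto
  next
    case PInf
    then show ?thesis using assms(2) I by auto
  next
    case MInf
    then have "(\<gamma> \<longlongrightarrow> x) at_bot" using start by simp
    then have "\<forall>\<^sub>F s in at_bot. dist (\<gamma> s) x < e" using \<open>0 < e\<close> by (rule tendstoD)
    moreover have "\<forall>\<^sub>F s in at_bot. s \<le> t" by (rule eventually_le_at_bot)
    ultimately have "\<forall>\<^sub>F s in at_bot. s \<le> t \<and> dist (\<gamma> s) x < e" by eventually_elim auto
    then obtain s where s: "s \<le> t" "dist (\<gamma> s) x < e"
      unfolding eventually_at_bot_linorder by blast
    moreover have "s \<in> I"
      using I MInf assms(2) s(1) order.trans[of "ereal s" "ereal t" b] by simp
    ultimately show ?thesis by blast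
  qed
qed

lemma path_near_end:
  assumes path: "path_from_to I \<gamma> x y" and "t \<in> I" "0 < (e::real)"
  shows "\<exists>s\<in>I. t \<le> s \<and> dist (\<gamma> s) y < e"
proof -
  obtain a b :: ereal where I: "I = {t. a \<le> ereal t \<and> ereal t \<le> b}"
      and finish: "if b = \<infinity> then (\<gamma> \<longlongrightarrow> y) at_top else \<gamma> (real_of_ereal b) = y"
    using path unfolding path_from_to_def by blast
  show ?thesis
  proof (cases b)
    case (real r)
    then have "\<gamma> r = y" "t \<le> r" using finish assms(2) I by auto
    moreover have "r \<in> I"
      using assms(2) I real \<open>t \<le> r\<close> order.trans[of a "ereal t" "ereal r"] by simp
    ultimately show ?thesis using \<open>0 < e\<close> by (intro bexI[of _ r]) auto
  next
    case MInf
    then show ?thesis using assms(2) I by auto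
  next
    case PInf
    then have "(\<gamma> \<longlongrightarrow> y) at_top" using finish by simp
    then have "\<forall>\<^sub>F s in at_top. dist (\<gamma> s) y < e" using \<open>0 < e\<close> by (rule tendstoD)
    moreover have "\<forall>\<^sub>F s in at_top. t \<le> s" by (rule eventually_ge_at_top)
    ultimately have "\<forall>\<^sub>F s in at_top. t \<le> s \<and> dist (\<gamma> s) y < e" by eventually_elim auto
    then obtain s where s: "t \<le> s" "dist (\<gamma> s) y < e"
      unfolding eventually_at_top_linorder by blast
    moreover have "s \<in> I"
      using I PInf assms(2) s(1) order.trans[of a "ereal t" "ereal s"] by simp
    ultimately show ?thesis by blast
  qed
qed

lemma curve_length_upper:
  assumes "1 \<le> N" "\<And>i. i \<le> N \<Longrightarrow> t i \<in> I" "\<And>i. i < N \<Longrightarrow> t i \<le> t (Suc i)"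
  shows "(\<Sum>i<N. ennreal (\<delta> (\<gamma> (t i)) (\<gamma> (t (Suc i))))) \<le> curve_length \<delta> I \<gamma>"
  unfolding curve_length_def using assms by (intro Sup_upper) blast

lemma curve_length_three_points:
  assumes "r \<in> I" "s \<in> I" "t \<in> I" "r \<le> s" "s \<le> t"
  shows "ennreal (\<delta> (\<gamma> r) (\<gamma> s)) + ennreal (\<delta> (\<gamma> s) (\<gamma> t)) \<le> curve_length \<delta> I \<gamma>"
proof -
  define p where "p = (\<lambda>i::nat. if i = 0 then r else if i = 1 then s else t)"
  have "(\<Sum>i<2. ennreal (\<delta> (\<gamma> (p i)) (\<gamma> (p (Suc i))))) \<le> curve_length \<delta> I \<gamma>"
    using assms by (intro curve_length_upper) (auto simp: p_def)
  then show ?thesis by (simp add: p_def numeral_2_eq_2)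
qed

locale proper_length_space =
  fixes space_type :: "'a::metric_space itself"
  assumes proper: "proper_metric_space (UNIV :: 'a set) dist"
    and length_sp: "length_space TYPE('a)"
begin

lemma closed_bounded_imp_compact: "compact S" if "closed S" "bounded S" for S :: "'a set"
proof -
  have "closedin Met_TC.mtopology S" "Met_TC.mbounded S" using that by auto
  then have "compactin Met_TC.mtopology S"
    using proper unfolding proper_metric_space_def by blast
  then show ?thesis by simp
qed

text \<open>
  Along a path of length at most \<open>dist x y + e\<close>, a point at distance \<open>s\<close> from \<open>x\<close> is nearly at distance
  \<open>dist x y - s\<close> from \<open>y\<close>. Since the sphere of radius \<open>s\<close> around \<open>x\<close> is compact, its point nearest
  to \<open>y\<close> achieves the limit \<open>e = 0\<close>.
\<close>

lemma intermediate_point: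
  fixes x y :: 'a
  assumes "0 \<le> s" "s \<le> dist x y"
  shows "\<exists>z. dist x z = s \<and> dist z y = dist x y - s"
proof -
  have approx: "\<exists>z. dist x z = s \<and> dist z y < dist x y - s + 3 * e"
    if e: "0 < e" and s: "0 < s" "s < dist x y" for e
  proof -
    have "Inf {curve_length dist I \<gamma> | I \<gamma>. path_from_to I \<gamma> x y} < ennreal (dist x y + e)"
      using length_sp e unfolding length_space_def by (metis (no_types, lifting) ennreal_lessI
          add_strict_increasing less_add_same_cancel1 zero_less_dist_iff le_less_trans zero_le_dist)
    then obtain I \<gamma> where path: "path_from_to I \<gamma> x y" and len: "curve_length dist I \<gamma> < ennreal (dist x y + e)"
      unfolding Inf_less_iff by blast
    have I: "is_interval I" "I \<noteq> {}" "continuous_on I \<gamma>"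
      using path path_from_to_is_interval[OF path] by (auto simp: path_from_to_def)
    then obtain t0 where t0: "t0 \<in> I" by blast
    obtain s1 where s1: "s1 \<in> I" "dist (\<gamma> s1) x < s" using path_near_start[OF path t0 s(1)] by blast
    obtain s2 where s2: "s2 \<in> I" "dist (\<gamma> s2) y < dist x y - s"
      using path_near_end[OF path t0, of "dist x y - s"] s by auto
    have "connected ((\<lambda>t. dist x (\<gamma> t)) ` I)"
      using I by (intro connected_continuous_image continuous_intros) (auto simp: is_interval_connected)
    moreover have "dist x (\<gamma> s1) \<le> s" "s \<le> dist x (\<gamma> s2)"
      using s1 s2 dist_triangle[of x y "\<gamma> s2"] by (auto simp: dist_commute)
    ultimately have "s \<in> (\<lambda>t. dist x (\<gamma> t)) ` I"
      using s1 s2 unfolding connected_iff_interval by blast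
    then obtain t where t: "t \<in> I" "dist x (\<gamma> t) = s" by blast
    obtain r1 where r1: "r1 \<in> I" "r1 \<le> t" "dist (\<gamma> r1) x < e" using path_near_start[OF path t(1) e] by blast
    obtain r2 where r2: "r2 \<in> I" "t \<le> r2" "dist (\<gamma> r2) y < e" using path_near_end[OF path t(1) e] by blast
    have "ennreal (dist (\<gamma> r1) (\<gamma> t) + dist (\<gamma> t) (\<gamma> r2)) \<le> curve_length dist I \<gamma>"
      using curve_length_three_points[of r1 I t r2 dist \<gamma>] r1 r2 t by simp
    also note len
    finally have "dist (\<gamma> r1) (\<gamma> t) + dist (\<gamma> t) (\<gamma> r2) < dist x y + e"
      by (simp add: ennreal_less_iff flip: ennreal_plus)
    then have "dist (\<gamma> t) y < dist x y - s + 3 * e"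
      using r1 r2 t dist_triangle[of x "\<gamma> t" "\<gamma> r1"] dist_triangle[of "\<gamma> t" y "\<gamma> r2"]
      by (simp add: dist_commute)
    then show ?thesis using t by blast
  qed
  consider "s = 0" | "s = dist x y" | "0 < s" "s < dist x y" using assms by linarith
  then show ?thesis
  proof cases
    case 3
    let ?S = "{z. dist x z = s}"
    have "compact ?S"
    proof (rule closed_bounded_imp_compact)
      show "closed ?S" by (intro closed_Collect_eq continuous_intros)
      show "bounded ?S" by (rule bounded_subset[OF bounded_cball[of x s]]) auto
    qed
    moreover have "?S \<noteq> {}" using approx[of 1] 3 by auto
    moreover have "continuous_on ?S (\<lambda>z. dist z y)" by (intro continuous_intros)
    ultimately obtain z where z: "z \<in> ?S" "\<And>w. w \<in> ?S \<Longrightarrow> dist z y \<le> dist w y"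
      using continuous_attains_inf[of ?S "\<lambda>z. dist z y"] by blast
    have "dist z y \<le> dist x y - s + e" if "0 < e" for e
      using approx[of "e / 3"] z(2) 3 that by fastforce
    then have "dist z y \<le> dist x y - s" by (rule field_le_epsilon)
    moreover have "dist x y \<le> dist x z + dist z y" by (rule dist_triangle)
    ultimately show ?thesis using z(1) by auto
  qed (auto intro: exI[of _ x] exI[of _ y])
qed

text \<open>
  Take a maximal isometric partial curve from \<open>[0, dist x y]\<close>, as a set of pairs, by Zorn's lemma. If it
  were undefined at some \<open>t\<close>, it could be extended: finitely many of the conditions on the new value
  are all satisfied by an intermediate point between the two nearest prescribed values, and
  compactness of a ball yields a point satisfying all of them.
\<close>

theorem geodesic_exists:
  fixes x y :: 'a
  obtains \<gamma> where "\<gamma> 0 = x" "\<gamma> (dist x y) = y"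
    "\<And>s t. s \<in> {0..dist x y} \<Longrightarrow> t \<in> {0..dist x y} \<Longrightarrow> dist (\<gamma> s) (\<gamma> t) = \<bar>s - t\<bar>"
proof -
  define D where "D = dist x y"
  define \<A> where "\<A> = {G :: (real \<times> 'a) set. (0, x) \<in> G \<and> (D, y) \<in> G \<and> fst ` G \<subseteq> {0..D} \<and>
      (\<forall>g\<in>G. \<forall>h\<in>G. dist (snd g) (snd h) = \<bar>fst g - fst h\<bar>)}"
  have "\<A> \<noteq> {}"
  proof -
    have "{(0, x), (D, y)} \<in> \<A>" by (auto simp: \<A>_def D_def dist_commute)
    then show ?thesis by blast
  qed
  moreover have "\<Union>\<C> \<in> \<A>" if C: "\<C> \<noteq> {}" "subset.chain \<A> \<C>" for \<C>
  proof -
    have sub: "\<And>G. G \<in> \<C> \<Longrightarrow> G \<in> \<A>" using C(2) by (auto simp: subset.chain_def)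
    have "dist (snd g) (snd h) = \<bar>fst g - fst h\<bar>" if gh: "g \<in> \<Union>\<C>" "h \<in> \<Union>\<C>" for g h
    proof -
      obtain G where G: "g \<in> G" "G \<in> \<C>" using gh(1) by (rule UnionE)
      obtain H where H: "h \<in> H" "H \<in> \<C>" using gh(2) by (rule UnionE)
      have "G \<subseteq> H \<or> H \<subseteq> G" using C(2) G H by (simp add: subset_chain_def)
      then obtain J where J: "J \<in> \<C>" "g \<in> J" "h \<in> J" using G H by (metis subsetD)
      then have "\<forall>g\<in>J. \<forall>h\<in>J. dist (snd g) (snd h) = \<bar>fst g - fst h\<bar>"
        using sub[of J] by (simp add: \<A>_def)
      then show ?thesis using J by blast
    qed
    moreover have "(0, x) \<in> G \<and> (D, y) \<in> G \<and> fst ` G \<subseteq> {0..D}" if "G \<in> \<C>" for G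
      using sub[OF that] by (simp add: \<A>_def)
    then have "(0, x) \<in> \<Union>\<C>" "(D, y) \<in> \<Union>\<C>" "fst ` \<Union>\<C> \<subseteq> {0..D}"
      using C(1) by blast+
    ultimately show ?thesis unfolding \<A>_def by simp
  qed
  ultimately have "\<exists>M\<in>\<A>. \<forall>X\<in>\<A>. M \<subseteq> X \<longrightarrow> X = M" by (rule subset_Zorn_nonempty)
  then obtain M where M: "M \<in> \<A>" "\<And>X. X \<in> \<A> \<Longrightarrow> M \<subseteq> X \<Longrightarrow> X = M" by blast
  have M0: "(0, x) \<in> M" "(D, y) \<in> M" "\<And>g. g \<in> M \<Longrightarrow> 0 \<le> fst g \<and> fst g \<le> D"
      "\<And>g h. g \<in> M \<Longrightarrow> h \<in> M \<Longrightarrow> dist (snd g) (snd h) = \<bar>fst g - fst h\<bar>"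
    using M(1) by (auto simp: \<A>_def)
  have dom: "\<exists>z. (t, z) \<in> M" if t: "t \<in> {0..D}" for t
  proof -
    have "cball x t \<inter> (\<Inter>g\<in>M. {z. dist z (snd g) = \<bar>t - fst g\<bar>}) \<noteq> {}"
    proof (rule compact_imp_fip_image)
      show "compact (cball x t)" by (rule closed_bounded_imp_compact) auto
      show "closed {z. dist z (snd g) = \<bar>t - fst g\<bar>}" for g
        by (intro closed_Collect_eq continuous_intros)
      fix F assume F: "finite F" "F \<subseteq> M"
      (* Adding the two endpoints ensures that t has prescribed values on both sides. *)
      define F' where "F' = insert (0, x) (insert (D, y) F)"
      have F': "finite F'" "F' \<subseteq> M" using F M0 by (auto simp: F'_def)
      let ?L = "{g \<in> F'. fst g \<le> t}" and ?R = "{g \<in> F'. t \<le> fst g}"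
      have "(0, x) \<in> ?L" "(D, y) \<in> ?R" using t by (auto simp: F'_def)
      then have "Max (fst ` ?L) \<in> fst ` ?L" "Min (fst ` ?R) \<in> fst ` ?R"
        using F'(1) by (intro Max_in Min_in; force)+
      then obtain l r where l: "l \<in> ?L" "Max (fst ` ?L) = fst l" and r: "r \<in> ?R" "Min (fst ` ?R) = fst r"
        by blast
      have lmax: "fst g \<le> fst l" if "g \<in> ?L" for g
        using F'(1) that by (simp flip: l(2))
      have rmin: "fst r \<le> fst g" if "g \<in> ?R" for g
        using F'(1) that by (simp flip: r(2))
      have lr: "dist (snd l) (snd r) = fst r - fst l" "fst l \<le> t" "t \<le> fst r"
        using M0(4)[of l r] l(1) r(1) F'(2) by auto
      obtain z where z: "dist (snd l) z = t - fst l" "dist z (snd r) = fst r - t"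
        using intermediate_point[of "t - fst l" "snd l" "snd r"] lr by auto
      have zg: "dist z (snd g) = \<bar>t - fst g\<bar>" if g: "g \<in> F'" for g
      proof -
        have lg: "dist (snd l) (snd g) = \<bar>fst l - fst g\<bar>" "dist (snd r) (snd g) = \<bar>fst r - fst g\<bar>"
          using M0(4) l(1) r(1) g F'(2) by blast+
        have tri: "dist z (snd g) \<le> dist z (snd l) + dist (snd l) (snd g)"
            "dist z (snd g) \<le> dist z (snd r) + dist (snd r) (snd g)"
            "dist (snd l) (snd g) \<le> dist (snd l) z + dist z (snd g)"
            "dist (snd r) (snd g) \<le> dist (snd r) z + dist z (snd g)"
          by (rule dist_triangle)+
        show ?thesis
        proof (cases "fst g \<le> t")
          case True
          then show ?thesis using lmax[of g] g lg tri z lr by (simp add: dist_commute)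
        next
          case False
          then show ?thesis using rmin[of g] g lg tri z lr by (simp add: dist_commute)
        qed
      qed
      have "z \<in> cball x t" using zg[of "(0, x)"] t by (simp add: F'_def dist_commute)
      moreover have "z \<in> (\<Inter>g\<in>F. {z. dist z (snd g) = \<bar>t - fst g\<bar>})" using zg by (auto simp: F'_def)
      ultimately show "cball x t \<inter> (\<Inter>g\<in>F. {z. dist z (snd g) = \<bar>t - fst g\<bar>}) \<noteq> {}" by blast
    qed
    then obtain z where z: "\<And>g. g \<in> M \<Longrightarrow> dist z (snd g) = \<bar>t - fst g\<bar>" by blast
    have "insert (t, z) M \<in> \<A>"
      using M0 z t by (auto simp: \<A>_def dist_commute abs_minus_commute)
    then have "insert (t, z) M = M" using M(2) by blast
    then show ?thesis by blast
  qed
  define \<gamma> where "\<gamma> t = (SOME z. (t, z) \<in> M)" for t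
  have \<gamma>: "(t, \<gamma> t) \<in> M" if "t \<in> {0..D}" for t
    unfolding \<gamma>_def using dom[OF that] by (rule someI_ex)
  have iso: "dist (\<gamma> s) (\<gamma> t) = \<bar>s - t\<bar>" if "s \<in> {0..D}" "t \<in> {0..D}" for s t
    using M0(4)[OF \<gamma>[OF that(1)] \<gamma>[OF that(2)]] by simp
  have "dist (\<gamma> 0) x = 0" "dist (\<gamma> D) y = 0"
    using M0(4)[OF \<gamma>[of 0] M0(1)] M0(4)[OF \<gamma>[of D] M0(2)] by (auto simp: D_def)
  then show ?thesis using that[of \<gamma>] iso by (auto simp: D_def)
qed

end

section \<open>Lower bounds from upper gradients\<close>

text \<open>
  With \<open>h = 1 / (n + 1)\<close>, the integral of \<open>\<phi> (t + h) - \<phi> t\<close> over \<open>[a, b - h]\<close> telescopes to the integral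
  of \<open>\<phi>\<close> over the last \<open>h\<close> minus the one over the first \<open>h\<close>. The Lipschitz bound costs at most
  \<open>C * h\<close> at either end.
\<close>

lemma increment_le_nn_integral_forward_quotient:
  fixes \<phi> :: "real \<Rightarrow> real"
  assumes lip: "C-lipschitz_on {a..b} \<phi>" and h: "1 / real (Suc n) \<le> b - a"
  shows "ennreal (\<phi> b - \<phi> a - 2 * C / real (Suc n)) \<le>
    (\<integral>\<^sup>+t. ennreal (forward_quotient (\<lambda>x y. \<bar>y - x\<bar>) {a..b} \<phi> n t) \<partial>lebesgue)"
proof -
  define h where "h = 1 / real (Suc n)"
  have h0: "0 < h" "h \<le> b - a" using h by (auto simp: h_def)
  have cont: "continuous_on S \<phi>" if "S \<subseteq> {a..b}" for S
    using lipschitz_on_continuous_on[OF lip] that by (rule continuous_on_subset)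
  have int: "\<phi> integrable_on {u..v}" if "a \<le> u" "v \<le> b" for u v
    using that by (intro integrable_continuous_real cont) auto
  define f where "f t = \<phi> (t + h) - \<phi> t" for t
  have contf: "continuous_on {a..b - h} f"
    unfolding f_def using h0
    by (intro continuous_intros cont continuous_on_compose2[OF cont[OF order.refl]]) auto
  have "integral {a..b - h} f = integral {a..b - h} (\<phi> \<circ> (\<lambda>t. t + h)) - integral {a..b - h} \<phi>"
    unfolding f_def o_def using h0
    by (intro integral_diff int integrable_continuous_real continuous_on_compose2[OF cont[OF order.refl]]
          continuous_intros) auto
  also have "integral {a..b - h} (\<phi> \<circ> (\<lambda>t. t + h)) = integral {a + h..b} \<phi>"
    using h0 by (subst integral_shift) (auto intro: cont)
  also have "integral {a + h..b} \<phi> - integral {a..b - h} \<phi> = integral {b - h..b} \<phi> - integral {a..a + h} \<phi>"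
    using Henstock_Kurzweil_Integration.integral_combine[of a "a + h" b \<phi>]
      Henstock_Kurzweil_Integration.integral_combine[of a "b - h" b \<phi>] int[of a b] h0 by auto
  finally have J: "integral {a..b - h} f = integral {b - h..b} \<phi> - integral {a..a + h} \<phi>" .
  have dist: "\<bar>\<phi> s - \<phi> t\<bar> \<le> C * \<bar>s - t\<bar>" if "s \<in> {a..b}" "t \<in> {a..b}" for s t
    using lipschitz_onD[OF lip that] by (simp add: dist_real_def)
  have C: "0 \<le> C" using lip by (rule lipschitz_on_nonneg)
  have "h * (\<phi> b - C * h) = integral {b - h..b} (\<lambda>_. \<phi> b - C * h)"
    using h0 by simp
  also have "\<dots> \<le> integral {b - h..b} \<phi>"
  proof (rule integral_le)
    fix t assume t: "t \<in> {b - h..b}"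
    then have "C * \<bar>b - t\<bar> \<le> C * h" using C by (intro mult_left_mono) auto
    then show "\<phi> b - C * h \<le> \<phi> t" using dist[of b t] t h0 by auto
  qed (use h0 in \<open>auto intro: int\<close>)
  finally have right: "h * (\<phi> b - C * h) \<le> integral {b - h..b} \<phi>" .
  have "integral {a..a + h} \<phi> \<le> integral {a..a + h} (\<lambda>_. \<phi> a + C * h)"
  proof (rule integral_le)
    fix t assume t: "t \<in> {a..a + h}"
    then have "C * \<bar>t - a\<bar> \<le> C * h" using C by (intro mult_left_mono) auto
    then show "\<phi> t \<le> \<phi> a + C * h" using dist[of t a] t h0 by auto
  qed (use h0 in \<open>auto intro: int\<close>)
  also have "\<dots> = h * (\<phi> a + C * h)" using h0 by simp
  finally have "integral {a..a + h} \<phi> \<le> h * (\<phi> a + C * h)" .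
  with right J have "h * (\<phi> b - \<phi> a - 2 * C * h) \<le> integral {a..b - h} f"
    by (simp add: algebra_simps)
  also have "\<dots> \<le> integral {a..b - h} (\<lambda>t. \<bar>f t\<bar>)"
    using contf by (intro integral_le integrable_continuous_real continuous_intros) auto
  finally have "real (Suc n) * (h * (\<phi> b - \<phi> a - 2 * C * h)) \<le> real (Suc n) * integral {a..b - h} (\<lambda>t. \<bar>f t\<bar>)"
    by (intro mult_left_mono) auto
  moreover have "real (Suc n) * h = 1" by (simp add: h_def)
  then have "real (Suc n) * (h * (\<phi> b - \<phi> a - 2 * C * h)) = \<phi> b - \<phi> a - 2 * C / real (Suc n)"
    by (simp add: h_def del: of_nat_Suc flip: mult.assoc)
  ultimately have "ennreal (\<phi> b - \<phi> a - 2 * C / real (Suc n)) \<le>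
      ennreal (real (Suc n) * integral {a..b - h} (\<lambda>t. \<bar>f t\<bar>))"
    by (intro ennreal_leI) linarith
  also have "\<dots> = ennreal (integral {a..b - h} (\<lambda>t. real (Suc n) * \<bar>f t\<bar>))"
    by simp
  also have "\<dots> = (\<integral>\<^sup>+t. ennreal (real (Suc n) * \<bar>f t\<bar>) * indicator {a..b - h} t \<partial>lborel)"
    using contf
    by (intro nn_integral_has_integral_lebesgue'[symmetric] integrable_integral integrable_continuous_real
          continuous_intros) auto
  also have "\<dots> = (\<integral>\<^sup>+t. ennreal (forward_quotient (\<lambda>x y. \<bar>y - x\<bar>) {a..b} \<phi> n t) \<partial>lebesgue)"
    unfolding nn_integral_completion forward_quotient_def h_def[symmetric]
    by (intro nn_integral_cong) (use h0 in \<open>auto simp: f_def indicator_def mult.commute\<close>)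
  finally show ?thesis .
qed

text \<open>
  The hypothesis \<open>slope\<close> says that \<open>K\<close> dominates the pointwise Lipschitz constant of \<open>\<Phi>\<close>. The difference
  quotients of \<open>\<Phi> \<circ> \<gamma>\<close> are uniformly bounded and their upper limit is at most the weighted speed almost
  everywhere, so the reverse Fatou lemma turns the telescoping bound into the claim. This avoids
  absolute continuity and the fundamental theorem for Lipschitz functions.
\<close>

lemma upper_gradient_increment:
  fixes K \<Phi> :: "'a::metric_space \<Rightarrow> real"
  assumes K: "continuous_on UNIV K" and K0: "\<And>x. 0 \<le> K x"
    and slope: "\<And>z e. 0 < e \<Longrightarrow> \<forall>\<^sub>F w in nhds z. \<bar>\<Phi> w - \<Phi> z\<bar> \<le> (K z + e) * dist z w"
    and \<Phi>_lip: "\<And>S. bounded S \<Longrightarrow> \<exists>C. C-lipschitz_on S \<Phi>"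
    and \<gamma>: "C-lipschitz_on {a..b} \<gamma>" and "a \<le> b"
  shows "ennreal (\<Phi> (\<gamma> b) - \<Phi> (\<gamma> a)) \<le> weighted_length K {a..b} \<gamma>"
proof (cases "a = b")
  case False
  then have ab: "a < b" using \<open>a \<le> b\<close> by simp
  define \<phi> where "\<phi> = \<Phi> \<circ> \<gamma>"
  have alm: "almost_lipschitz {a..b} \<gamma>" using \<gamma> by (rule lipschitz_on_imp_almost_lipschitz)
  have "compact (\<gamma> ` {a..b})"
    using lipschitz_on_continuous_on[OF \<gamma>] by (intro compact_continuous_image) auto
  then obtain D where "D-lipschitz_on (\<gamma> ` {a..b}) \<Phi>"
    using \<Phi>_lip compact_imp_bounded by blast
  then have \<phi>: "(D * C)-lipschitz_on {a..b} \<phi>"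
    unfolding \<phi>_def using \<gamma> by (intro lipschitz_on_compose)
  define L where "L = D * C"
  have L: "0 \<le> L" "\<And>s t. s \<in> {a..b} \<Longrightarrow> t \<in> {a..b} \<Longrightarrow> \<bar>\<phi> s - \<phi> t\<bar> \<le> L * \<bar>s - t\<bar>"
    using lipschitz_on_nonneg[OF \<phi>] lipschitz_onD[OF \<phi>] by (auto simp: L_def dist_real_def)
  define u where "u n t = ennreal (forward_quotient (\<lambda>x y. \<bar>y - x\<bar>) {a..b} \<phi> n t)" for n t
  have u_meas: "u n \<in> borel_measurable lebesgue" for n
  proof -
    have "continuous_on ({a..b} \<inter> {t. t + h \<in> {a..b}}) (\<lambda>t. \<bar>\<phi> (t + h) - \<phi> t\<bar>)" for h
      using lipschitz_on_continuous_on[OF \<phi>]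
      by (intro continuous_intros continuous_on_shift) (auto elim: continuous_on_subset)
    then have "forward_quotient (\<lambda>x y. \<bar>y - x\<bar>) {a..b} \<phi> n \<in> borel_measurable borel"
      by (intro forward_quotient_measurable) auto
    then have "u n \<in> borel_measurable borel" unfolding u_def by measurable
    then show ?thesis by (simp add: measurable_completion)
  qed
  have u_bound: "u n t \<le> ennreal L * indicator {a..b} t" for n t
  proof (cases "t \<in> {a..b} \<inter> {t. t + 1 / real (Suc n) \<in> {a..b}}")
    case True
    then have "\<bar>\<phi> (t + 1 / real (Suc n)) - \<phi> t\<bar> * real (Suc n) \<le> (L * (1 / real (Suc n))) * real (Suc n)"
      using L(2)[of "t + 1 / real (Suc n)" t] by (intro mult_right_mono) auto
    then show ?thesis
      using True L(1) by (simp add: u_def forward_quotient_def indicator_def ennreal_leI del: of_nat_Suc)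
  qed (auto simp: u_def forward_quotient_def)
  have fin: "(\<integral>\<^sup>+t. ennreal L * indicator {a..b} t \<partial>lebesgue) < \<infinity>"
    using ab by (simp add: nn_integral_cmult_indicator ennreal_mult_less_top)
  have lim: "(\<lambda>n. \<phi> b - \<phi> a - 2 * L / real (Suc n)) \<longlonglongrightarrow> \<phi> b - \<phi> a"
    using tendsto_diff[OF tendsto_const tendsto_mult[OF tendsto_const LIMSEQ_inverse_real_of_nat],
        of "\<phi> b - \<phi> a" "2 * L"] by (simp add: inverse_eq_divide del: of_nat_Suc)
  have "ennreal (\<phi> b - \<phi> a) = limsup (\<lambda>n. ennreal (\<phi> b - \<phi> a - 2 * L / real (Suc n)))"
    using tendsto_ennrealI[OF lim] by (intro lim_imp_Limsup[symmetric]) auto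
  also have "\<dots> \<le> limsup (\<lambda>n. \<integral>\<^sup>+t. u n t \<partial>lebesgue)"
  proof (rule Limsup_mono)
    have "\<forall>\<^sub>F n in sequentially. 1 / real (Suc n) < b - a"
      using order_tendstoD(2)[OF LIMSEQ_inverse_real_of_nat, of "b - a"] ab by (simp add: inverse_eq_divide)
    then show "\<forall>\<^sub>F n in sequentially. ennreal (\<phi> b - \<phi> a - 2 * L / real (Suc n)) \<le> (\<integral>\<^sup>+t. u n t \<partial>lebesgue)"
      by eventually_elim (use increment_le_nn_integral_forward_quotient[OF \<phi>] in \<open>simp add: u_def L_def\<close>)
  qed
  also have "\<dots> \<le> (\<integral>\<^sup>+t. limsup (\<lambda>n. u n t) \<partial>lebesgue)"
  proof (rule nn_integral_limsup[OF u_meas _ _ fin])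
    show "(\<lambda>t. ennreal L * indicator {a..b} t) \<in> borel_measurable lebesgue"
      by (intro borel_measurable_times_ennreal borel_measurable_indicator borel_measurable_const) auto
  qed (use u_bound in auto)
  also have "\<dots> \<le> (\<integral>\<^sup>+t\<in>{a..b}. weighted_speed K \<gamma> t \<partial>lebesgue)"
  proof (rule nn_integral_mono_AE)
    have "is_interval {a..b}" by simp
    from AE_has_metric_deriv[OF this alm]
    show "AE t in lebesgue. limsup (\<lambda>n. u n t) \<le> weighted_speed K \<gamma> t * indicator {a..b} t"
    proof eventually_elim
      case (elim t)
      show ?case
      proof (cases "t \<in> {a..b}")
        case True
        then obtain v where v: "has_metric_deriv dist UNIV \<gamma> t v" and t: "t \<in> interior {a..b}"
          using elim by blast
        have fq: "(\<lambda>n. forward_quotient dist {a..b} \<gamma> n t) \<longlonglongrightarrow> v"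
          using v t by (rule forward_quotient_tendsto)
        have "0 \<le> v"
          using fq by (rule LIMSEQ_le_const) (auto simp: forward_quotient_def)
        have bound: "limsup (\<lambda>n. u n t) \<le> ennreal ((K (\<gamma> t) + e) * v)" if "0 < e" for e
        proof -
          have "continuous (at t) \<gamma>"
            using lipschitz_on_continuous_on[OF \<gamma>] t by (rule continuous_on_interior)
          then have "(\<gamma> \<longlongrightarrow> \<gamma> t) (nhds t)" by (simp add: continuous_at tendsto_at_iff_tendsto_nhds)
          moreover have "(\<lambda>n. t + 1 / real (Suc n)) \<longlonglongrightarrow> t"
            using tendsto_add[OF tendsto_const[of t] LIMSEQ_inverse_real_of_nat]
            by (simp add: inverse_eq_divide)
          ultimately have "(\<lambda>n. \<gamma> (t + 1 / real (Suc n))) \<longlonglongrightarrow> \<gamma> t"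
            by (rule filterlim_compose)
          then have "\<forall>\<^sub>F n in sequentially. \<bar>\<Phi> (\<gamma> (t + 1 / real (Suc n))) - \<Phi> (\<gamma> t)\<bar>
              \<le> (K (\<gamma> t) + e) * dist (\<gamma> t) (\<gamma> (t + 1 / real (Suc n)))"
            using slope[OF that, of "\<gamma> t"] by (rule eventually_compose_filterlim[rotated])
          then have "\<forall>\<^sub>F n in sequentially. u n t \<le> ennreal ((K (\<gamma> t) + e) * forward_quotient dist {a..b} \<gamma> n t)"
          proof eventually_elim
            case (elim n)
            then have "\<bar>\<Phi> (\<gamma> (t + 1 / real (Suc n))) - \<Phi> (\<gamma> t)\<bar> * real (Suc n)
              \<le> (K (\<gamma> t) + e) * dist (\<gamma> t) (\<gamma> (t + 1 / real (Suc n))) * real (Suc n)"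
              by (intro mult_right_mono) auto
            then show ?case
              by (auto simp: u_def forward_quotient_def \<phi>_def mult.assoc simp del: of_nat_Suc intro!: ennreal_leI)
          qed
          then have "limsup (\<lambda>n. u n t) \<le> limsup (\<lambda>n. ennreal ((K (\<gamma> t) + e) * forward_quotient dist {a..b} \<gamma> n t))"
            by (rule Limsup_mono)
          also have "\<dots> = ennreal ((K (\<gamma> t) + e) * v)"
            by (intro lim_imp_Limsup tendsto_ennrealI tendsto_mult tendsto_const fq) auto
          finally show ?thesis .
        qed
        have "limsup (\<lambda>n. u n t) \<le> ennreal (K (\<gamma> t) * v)"
        proof (rule ennreal_le_epsilon)
          fix e :: real assume e: "0 < e"
          then have "(e / (v + 1)) * v \<le> e" using \<open>0 \<le> v\<close> by (simp add: field_simps)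
          then have "(K (\<gamma> t) + e / (v + 1)) * v \<le> K (\<gamma> t) * v + e" by (simp add: distrib_right)
          then have "ennreal ((K (\<gamma> t) + e / (v + 1)) * v) \<le> ennreal (K (\<gamma> t) * v) + ennreal e"
            using K0 \<open>0 \<le> v\<close> e by (simp add: ennreal_leI flip: ennreal_plus)
          moreover have "0 < e / (v + 1)" using e \<open>0 \<le> v\<close> by simp
          ultimately show "limsup (\<lambda>n. u n t) \<le> ennreal (K (\<gamma> t) * v) + ennreal e"
            using bound order.trans by blast
        qed
        then show ?thesis
          using True has_metric_deriv_imp_metric_deriv[OF v] by (simp add: weighted_speed_def)
      next
        case False
        then have "u n t = 0" for n by (auto simp: u_def forward_quotient_def)
        then show ?thesis by (simp add: Limsup_const)
      qed
    qed
  qed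
  also have "\<dots> = weighted_length K {a..b} \<gamma>" by (simp add: weighted_length_eq)
  finally show ?thesis by (simp add: \<phi>_def)
qed simp

lemma upper_gradient_le_lipschitz_cost:
  fixes K \<Phi> :: "'a::metric_space \<Rightarrow> real"
  assumes "continuous_on UNIV K" "\<And>x. 0 \<le> K x"
    and "\<And>z e. 0 < e \<Longrightarrow> \<forall>\<^sub>F w in nhds z. \<bar>\<Phi> w - \<Phi> z\<bar> \<le> (K z + e) * dist z w"
    and "\<And>S. bounded S \<Longrightarrow> \<exists>C. C-lipschitz_on S \<Phi>"
  shows "ennreal (\<Phi> y - \<Phi> x) \<le> lipschitz_cost K x y"
  unfolding lipschitz_cost_def
proof (rule Inf_greatest)
  fix c assume "c \<in> {c. lipschitz_connection K x y c}"
  then obtain a b \<gamma> C where "a \<le> b" "C-lipschitz_on {a..b} \<gamma>" "\<gamma> a = x" "\<gamma> b = y"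
      "c = weighted_length K {a..b} \<gamma>"
    unfolding lipschitz_connection_def by blast
  then show "ennreal (\<Phi> y - \<Phi> x) \<le> c"
    using upper_gradient_increment[of K \<Phi> C a b \<gamma>] assms by auto
qed

section \<open>The weighted distance as a cost of Lipschitz connections\<close>

locale weighted_space = proper_length_space space_type
  for space_type :: "'a::metric_space itself" +
  fixes K :: "'a \<Rightarrow> real"
  assumes K_nonneg: "\<And>x. 0 \<le> K x"
    and K_cont: "continuous_on UNIV K"
begin

text \<open>
  A geodesic has unit speed and stays within distance \<open>dist x y\<close> of \<open>x\<close>.
\<close>

lemma lipschitz_cost_le_dist:
  assumes M: "\<And>z. dist x z \<le> dist x y \<Longrightarrow> K z \<le> M"
  shows "lipschitz_cost K x y \<le> ennreal (M * dist x y)"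
proof -
  obtain \<gamma> where \<gamma>: "\<gamma> 0 = x" "\<gamma> (dist x y) = y"
    "\<And>s t. s \<in> {0..dist x y} \<Longrightarrow> t \<in> {0..dist x y} \<Longrightarrow> dist (\<gamma> s) (\<gamma> t) = \<bar>s - t\<bar>"
    using geodesic_exists by blast
  have "0 \<le> M" using M[of x] K_nonneg[of x] by simp
  have "1-lipschitz_on {0..dist x y} \<gamma>"
    using \<gamma>(3) by (intro lipschitz_onI) (auto simp: dist_real_def)
  then have "lipschitz_connection K x y (weighted_length K {0..dist x y} \<gamma>)"
    unfolding lipschitz_connection_def using \<gamma> zero_le_dist by blast
  then have "lipschitz_cost K x y \<le> weighted_length K {0..dist x y} \<gamma>"
    by (rule lipschitz_cost_lower)
  also have "\<dots> = (\<integral>\<^sup>+t\<in>{0..dist x y}. weighted_speed K \<gamma> t \<partial>lebesgue)"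
    by (simp add: weighted_length_eq)
  also have "\<dots> \<le> (\<integral>\<^sup>+t. ennreal M * indicator {0..dist x y} t \<partial>lebesgue)"
  proof (rule nn_integral_mono_AE)
    have "is_interval {0..dist x y}" by simp
    from AE_interior_interval[OF this]
    show "AE t in lebesgue. weighted_speed K \<gamma> t * indicator {0..dist x y} t
        \<le> ennreal M * indicator {0..dist x y} t"
    proof eventually_elim
      case (elim t)
      show ?case
      proof (cases "t \<in> {0..dist x y}")
        case True
        then have t: "t \<in> interior {0..dist x y}" using elim by blast
        have "has_metric_deriv dist {0..dist x y} \<gamma> t 1"
          unfolding has_metric_deriv_def
        proof (rule tendsto_eventually)
          show "\<forall>\<^sub>F s in at t within {0..dist x y}. dist (\<gamma> t) (\<gamma> s) / \<bar>t - s\<bar> = 1"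
            unfolding eventually_at_filter using \<gamma>(3)[OF True] by (intro always_eventually) auto
        qed
        then have "metric_deriv dist UNIV \<gamma> t = 1"
          unfolding has_metric_deriv_interior[OF t] by (rule has_metric_deriv_imp_metric_deriv)
        moreover have "K (\<gamma> t) \<le> M" using \<gamma>(3)[of 0 t] True \<gamma>(1) by (intro M) auto
        ultimately show ?thesis by (simp add: weighted_speed_def mult_right_mono ennreal_leI)
      qed auto
    qed
  qed
  also have "\<dots> = ennreal (M * dist x y)"
    using \<open>0 \<le> M\<close> by (simp add: nn_integral_cmult_indicator ennreal_mult)
  finally show ?thesis .
qed

lemma bounded_above_on_ball: "\<exists>M>0. \<forall>z\<in>cball x r. K z \<le> M"
proof -
  have "compact (K ` cball x r)"
    by (intro compact_continuous_image continuous_on_subset[OF K_cont] closed_bounded_imp_compact) auto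
  then obtain M where M: "\<And>z. z \<in> cball x r \<Longrightarrow> \<bar>K z\<bar> \<le> M"
    using compact_imp_bounded[of "K ` cball x r"] by (auto simp: bounded_iff simp del: mem_cball)
  have "\<forall>z\<in>cball x r. K z \<le> max M 1"
  proof
    show "K z \<le> max M 1" if "z \<in> cball x r" for z using M[OF that] by linarith
  qed
  then show ?thesis by (intro exI[of _ "max M 1"]) auto
qed

lemma lipschitz_cost_finite: "lipschitz_cost K x y < \<infinity>"
proof -
  obtain M where "\<forall>z\<in>cball x (dist x y). K z \<le> M" using bounded_above_on_ball by blast
  then have "lipschitz_cost K x y \<le> ennreal (M * dist x y)" by (intro lipschitz_cost_le_dist) auto
  also have "\<dots> < \<infinity>" by simp
  finally show ?thesis .
qed

lemma lipschitz_cost_self [simp]: "lipschitz_cost K x x = 0"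
  using lipschitz_cost_le_dist[of x x "K x"] by simp

lemma lipschitz_cost_small:
  assumes "0 < (e::real)"
  shows "\<exists>d>0. \<forall>y. dist x y < d \<longrightarrow> lipschitz_cost K x y \<le> ennreal e"
proof -
  obtain M where M: "0 < M" "\<forall>z\<in>cball x 1. K z \<le> M" using bounded_above_on_ball by blast
  have "lipschitz_cost K x y \<le> ennreal e" if y: "dist x y < min 1 (e / M)" for y
  proof -
    have "lipschitz_cost K x y \<le> ennreal (M * dist x y)" using M y by (intro lipschitz_cost_le_dist) auto
    also have "M * dist x y \<le> e" using y M(1) by (simp add: field_simps)
    then have "ennreal (M * dist x y) \<le> ennreal e" by (rule ennreal_leI)
    finally show ?thesis .
  qed
  then show ?thesis using M(1) assms by (intro exI[of _ "min 1 (e / M)"]) auto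
qed

text \<open>
  Between consecutive exceptional points the curve is Lipschitz on every slightly smaller compact
  interval and thus itself a competitor there. The two short gaps left at the ends cost little, since
  the cost is continuous along the curve. Induction on the number of exceptional points in between,
  by the triangle inequality, gives the general case.
\<close>

lemma lipschitz_cost_along_curve:
  assumes I: "is_interval I" and \<gamma>: "almost_lipschitz I \<gamma>" and uv: "u \<le> v" "u \<in> I" "v \<in> I"
  shows "lipschitz_cost K (\<gamma> u) (\<gamma> v) \<le> weighted_length K {u..v} \<gamma>"
proof -
  have cont: "continuous_on I \<gamma>" using \<gamma> by (simp add: almost_lipschitz_def)
  obtain B where B: "finite B" "\<And>u v. {u..v} \<subseteq> interior I - B \<Longrightarrow> \<exists>C. C-lipschitz_on {u..v} \<gamma>"
    using \<gamma> unfolding almost_lipschitz_def by blast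
  have near: "\<exists>d>0. \<forall>s\<in>I. \<bar>s - t\<bar> < d \<longrightarrow> lipschitz_cost K (\<gamma> t) (\<gamma> s) \<le> ennreal e"
    if te: "t \<in> I" "0 < e" for t e
  proof -
    obtain r where r: "0 < r" "\<And>y. dist (\<gamma> t) y < r \<Longrightarrow> lipschitz_cost K (\<gamma> t) y \<le> ennreal e"
      using lipschitz_cost_small[OF te(2)] by blast
    obtain d where "0 < d" "\<And>s. s \<in> I \<Longrightarrow> dist s t < d \<Longrightarrow> dist (\<gamma> s) (\<gamma> t) < r"
      using cont te(1) r(1) unfolding continuous_on_iff by blast
    then show ?thesis using r(2) by (intro exI[of _ d]) (auto simp: dist_real_def dist_commute)
  qed
  show ?thesis
    using uv
  proof (induction "card (B \<inter> {u<..<v})" arbitrary: u v rule: less_induct)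
    case less
    have sub: "{u..v} \<subseteq> I" using is_interval_Icc_subset[OF I] less.prems by blast
    show ?case
    proof (cases "B \<inter> {u<..<v} = {}")
      case False
      then obtain w where w: "w \<in> B" "u < w" "w < v" by auto
      have "B \<inter> {u<..<w} \<subset> B \<inter> {u<..<v}" "B \<inter> {w<..<v} \<subset> B \<inter> {u<..<v}" using w by auto
      then have "card (B \<inter> {u<..<w}) < card (B \<inter> {u<..<v})" "card (B \<inter> {w<..<v}) < card (B \<inter> {u<..<v})"
        using B(1) by (auto intro!: psubset_card_mono)
      moreover have "w \<in> I" using sub w by auto
      ultimately have "lipschitz_cost K (\<gamma> u) (\<gamma> w) \<le> weighted_length K {u..w} \<gamma>"
          "lipschitz_cost K (\<gamma> w) (\<gamma> v) \<le> weighted_length K {w..v} \<gamma>"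
        using less.hyps less.prems w by auto
      then have "lipschitz_cost K (\<gamma> u) (\<gamma> v) \<le> weighted_length K {u..w} \<gamma> + weighted_length K {w..v} \<gamma>"
        by (rule order.trans[OF lipschitz_cost_triangle[OF K_cont] add_mono])
      also have "\<dots> = weighted_length K {u..v} \<gamma>"
        using w by (intro weighted_length_split[OF I \<gamma> K_cont sub, symmetric]) auto
      finally show ?thesis .
    next
      case True
      show ?thesis
      proof (cases "u = v")
        case False
        then have "u < v" using less.prems by simp
        have "{u<..<v} \<subseteq> I" using sub by auto
        then have "{u<..<v} \<subseteq> interior I" by (intro interior_maximal) auto
        then have int: "{u<..<v} \<subseteq> interior I - B" using True by auto
        show ?thesis
        proof (rule ennreal_le_epsilon)
          fix e :: real assume "0 < e"
          then obtain d where d: "0 < d" "\<And>s. s \<in> I \<Longrightarrow> \<bar>s - u\<bar> < d \<Longrightarrow> lipschitz_cost K (\<gamma> u) (\<gamma> s) \<le> ennreal (e / 2)"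
            using near[of u "e / 2"] less.prems by auto
          obtain d' where d': "0 < d'" "\<And>s. s \<in> I \<Longrightarrow> \<bar>s - v\<bar> < d' \<Longrightarrow> lipschitz_cost K (\<gamma> v) (\<gamma> s) \<le> ennreal (e / 2)"
            using near[of v "e / 2"] less.prems \<open>0 < e\<close> by auto
          (* Dividing by three leaves a non-degenerate interval [s, t] between the two gaps. *)
          define s where "s = u + min d (v - u) / 3"
          define t where "t = v - min d' (v - u) / 3"
          have st: "u < s" "s \<le> t" "t < v" "\<bar>s - u\<bar> < d" "\<bar>t - v\<bar> < d'"
            using d(1) d'(1) \<open>u < v\<close> by (auto simp: s_def t_def min_def field_simps)
          then have sI: "s \<in> I" "t \<in> I" using sub by auto
          have "{s..t} \<subseteq> interior I - B" using st int by (auto simp: subset_iff)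
          then obtain C where "C-lipschitz_on {s..t} \<gamma>" using B(2) by blast
          then have "lipschitz_connection K (\<gamma> s) (\<gamma> t) (weighted_length K {s..t} \<gamma>)"
            unfolding lipschitz_connection_def using st(2) by blast
          then have "lipschitz_cost K (\<gamma> s) (\<gamma> t) \<le> weighted_length K {s..t} \<gamma>"
            by (rule lipschitz_cost_lower)
          also have "\<dots> \<le> weighted_length K {u..v} \<gamma>"
            using st by (intro weighted_length_mono) auto
          finally have mid: "lipschitz_cost K (\<gamma> s) (\<gamma> t) \<le> weighted_length K {u..v} \<gamma>" .
          have "lipschitz_cost K (\<gamma> u) (\<gamma> v) \<le> lipschitz_cost K (\<gamma> u) (\<gamma> s) + lipschitz_cost K (\<gamma> s) (\<gamma> v)"
            by (rule lipschitz_cost_triangle[OF K_cont])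
          also have "\<dots> \<le> lipschitz_cost K (\<gamma> u) (\<gamma> s) + (lipschitz_cost K (\<gamma> s) (\<gamma> t) + lipschitz_cost K (\<gamma> t) (\<gamma> v))"
            by (intro add_mono lipschitz_cost_triangle[OF K_cont] order.refl)
          also have "\<dots> \<le> ennreal (e / 2) + (weighted_length K {u..v} \<gamma> + ennreal (e / 2))"
            using d(2)[OF sI(1) st(4)] d'(2)[OF sI(2) st(5)] mid
            by (intro add_mono) (auto simp: lipschitz_cost_commute[OF K_cont, of "\<gamma> t" "\<gamma> v"])
          also have "\<dots> = weighted_length K {u..v} \<gamma> + ennreal e"
            using \<open>0 < e\<close> by (simp add: ac_simps flip: ennreal_plus)
          finally show "lipschitz_cost K (\<gamma> u) (\<gamma> v) \<le> weighted_length K {u..v} \<gamma> + ennreal e" .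
        qed
      qed simp
    qed
  qed
qed

lemma lipschitz_curve_is_piecewise_path:
  assumes "a \<le> b" "C-lipschitz_on {a..b} \<gamma>"
  shows "piecewise_loc_lipschitz {a..b} \<gamma>" "path_from_to {a..b} \<gamma> (\<gamma> a) (\<gamma> b)"
proof -
  have cont: "continuous_on {a..b} \<gamma>" using assms(2) by (rule lipschitz_on_continuous_on)
  define t where "t i = (if i = 0 then ereal a else ereal b)" for i :: nat
  (* A one-point interval admits only the partition with n = 0. *)
  define n :: nat where "n = (if a = b then 0 else 1)"
  have "Inf (ereal ` {a..b}) = ereal a" "Sup (ereal ` {a..b}) = ereal b"
    using assms(1) by (auto intro!: Inf_eqI Sup_eqI)
  moreover have "loc_lipschitz dist ({a..b} \<inter> S) \<gamma>" for S
    unfolding loc_lipschitz_def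
  proof (intro ballI exI conjI)
    show "dist (\<gamma> r) (\<gamma> s) \<le> C * \<bar>r - s\<bar>"
      if "r \<in> {a..b} \<inter> S \<inter> ball t 1" "s \<in> {a..b} \<inter> S \<inter> ball t 1" for r s t
      using lipschitz_onD[OF assms(2), of r s] that by (simp add: dist_real_def)
  qed simp
  ultimately have "t 0 = Inf (ereal ` {a..b})" "t n = Sup (ereal ` {a..b})" "\<forall>i<n. t i < t (Suc i)"
    "\<forall>i<n. loc_lipschitz dist ({a..b} \<inter> {s. t i < ereal s \<and> ereal s < t (Suc i)}) \<gamma>"
    using assms(1) by (auto simp: t_def n_def)
  then show "piecewise_loc_lipschitz {a..b} \<gamma>"
    unfolding piecewise_loc_lipschitz_def using cont by blast
  show "path_from_to {a..b} \<gamma> (\<gamma> a) (\<gamma> b)"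
    unfolding path_from_to_def
    using assms(1) cont by (intro conjI exI[of _ "ereal a"] exI[of _ "ereal b"]) auto
qed

text \<open>
  Every admissible path can be cut off near its possibly infinite ends; connecting the cut-off points to
  the endpoints by short geodesics costs arbitrarily little.
\<close>

theorem weighted_edist_eq_lipschitz_cost: "weighted_edist K x y = lipschitz_cost K x y"
proof (rule antisym)
  show "weighted_edist K x y \<le> lipschitz_cost K x y"
    unfolding lipschitz_cost_def
  proof (rule Inf_greatest)
    fix c assume "c \<in> {c. lipschitz_connection K x y c}"
    then obtain a b \<gamma> C where "a \<le> b" "C-lipschitz_on {a..b} \<gamma>" "\<gamma> a = x" "\<gamma> b = y"
        "c = weighted_length K {a..b} \<gamma>"
      unfolding lipschitz_connection_def by blast
    then show "weighted_edist K x y \<le> c"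
      unfolding weighted_edist_def using lipschitz_curve_is_piecewise_path[of a b C \<gamma>]
      by (intro Inf_lower) blast
  qed
  show "lipschitz_cost K x y \<le> weighted_edist K x y"
    unfolding weighted_edist_def
  proof (rule Inf_greatest)
    fix c assume "c \<in> {weighted_length K I \<gamma> | I \<gamma>. piecewise_loc_lipschitz I \<gamma> \<and> path_from_to I \<gamma> x y}"
    then obtain I \<gamma> where c: "c = weighted_length K I \<gamma>" and \<gamma>: "piecewise_loc_lipschitz I \<gamma>"
        and path: "path_from_to I \<gamma> x y"
      by blast
    have I: "is_interval I" using path by (rule path_from_to_is_interval)
    obtain t where t: "t \<in> I" using path unfolding path_from_to_def by blast
    show "lipschitz_cost K x y \<le> c"
    proof (rule ennreal_le_epsilon)
      fix e :: real assume "0 < e"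
      then obtain d where d: "0 < d" "\<And>z. dist x z < d \<Longrightarrow> lipschitz_cost K x z \<le> ennreal (e / 2)"
        using lipschitz_cost_small[of "e / 2" x] by auto
      obtain d' where d': "0 < d'" "\<And>z. dist y z < d' \<Longrightarrow> lipschitz_cost K y z \<le> ennreal (e / 2)"
        using lipschitz_cost_small[of "e / 2" y] \<open>0 < e\<close> by auto
      obtain r where r: "r \<in> I" "r \<le> t" "dist (\<gamma> r) x < d" using path_near_start[OF path t d(1)] by blast
      obtain s where s: "s \<in> I" "t \<le> s" "dist (\<gamma> s) y < d'" using path_near_end[OF path t d'(1)] by blast
      have "{r..s} \<subseteq> I" using I r(1) s(1) by (rule is_interval_Icc_subset)
      have "lipschitz_cost K (\<gamma> r) (\<gamma> s) \<le> weighted_length K {r..s} \<gamma>"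
        using r s by (intro lipschitz_cost_along_curve[OF I] piecewise_imp_almost_lipschitz \<gamma>) auto
      also have "\<dots> \<le> c"
        unfolding c using \<open>{r..s} \<subseteq> I\<close> I by (intro weighted_length_mono) auto
      finally have mid: "lipschitz_cost K (\<gamma> r) (\<gamma> s) \<le> c" .
      have "lipschitz_cost K x y \<le> lipschitz_cost K x (\<gamma> r) + lipschitz_cost K (\<gamma> r) y"
        by (rule lipschitz_cost_triangle[OF K_cont])
      also have "\<dots> \<le> lipschitz_cost K x (\<gamma> r) + (lipschitz_cost K (\<gamma> r) (\<gamma> s) + lipschitz_cost K (\<gamma> s) y)"
        by (intro add_mono lipschitz_cost_triangle[OF K_cont] order.refl)
      also have "\<dots> \<le> ennreal (e / 2) + (c + ennreal (e / 2))"
        using d(2)[of "\<gamma> r"] d'(2)[of "\<gamma> s"] r(3) s(3) mid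
        by (intro add_mono) (auto simp: dist_commute lipschitz_cost_commute[OF K_cont, of "\<gamma> s" y])
      also have "\<dots> = c + ennreal e"
        using \<open>0 < e\<close> by (simp add: ac_simps flip: ennreal_plus)
      finally show "lipschitz_cost K x y \<le> c + ennreal e" .
    qed
  qed
qed

end

section \<open>Curve length and difference quotients\<close>

text \<open>
  Any partition of \<open>S\<close> can be prolonged by the two points \<open>s\<close> and \<open>t\<close>.
\<close>

lemma curve_length_append:
  assumes S: "S \<subseteq> {..s}" "S \<noteq> {}" and "S \<subseteq> I" "s \<in> I" "t \<in> I" "s \<le> t"
  shows "curve_length \<delta> S \<gamma> + ennreal (\<delta> (\<gamma> s) (\<gamma> t)) \<le> curve_length \<delta> I \<gamma>"
proof -
  define A where "A = {(\<Sum>i<N. ennreal (\<delta> (\<gamma> (p i)) (\<gamma> (p (Suc i))))) | N (p :: nat \<Rightarrow> real).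
          N \<ge> 1 \<and> (\<forall>i\<le>N. p i \<in> S) \<and> (\<forall>i<N. p i \<le> p (Suc i))}"
  have A: "curve_length \<delta> S \<gamma> = (SUP x\<in>A. x)"
    by (simp add: curve_length_def A_def)
  obtain r where "r \<in> S" using S(2) by blast
  then have "(\<Sum>i<(1::nat). ennreal (\<delta> (\<gamma> r) (\<gamma> r))) \<in> A"
    unfolding A_def by (intro CollectI exI[of _ "1::nat"] exI[of _ "\<lambda>_. r"]) auto
  then have "A \<noteq> {}" by blast
  then have "curve_length \<delta> S \<gamma> + ennreal (\<delta> (\<gamma> s) (\<gamma> t)) = (SUP x\<in>A. x + ennreal (\<delta> (\<gamma> s) (\<gamma> t)))"
    unfolding A by (rule ennreal_SUP_add_left[symmetric])
  also have "\<dots> \<le> curve_length \<delta> I \<gamma>"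
  proof (rule SUP_least)
    fix x assume "x \<in> A"
    then obtain N and p :: "nat \<Rightarrow> real" where p: "N \<ge> 1" "\<And>i. i \<le> N \<Longrightarrow> p i \<in> S" "\<And>i. i < N \<Longrightarrow> p i \<le> p (Suc i)"
        and x: "x = (\<Sum>i<N. ennreal (\<delta> (\<gamma> (p i)) (\<gamma> (p (Suc i)))))"
      unfolding A_def by blast
    define p' where "p' i = (if i \<le> N then p i else if i = Suc N then s else t)" for i
    have "x = (\<Sum>i<N. ennreal (\<delta> (\<gamma> (p' i)) (\<gamma> (p' (Suc i)))))"
      unfolding x by (intro sum.cong) (auto simp: p'_def)
    then have "x + ennreal (\<delta> (\<gamma> s) (\<gamma> t)) \<le> (\<Sum>i<Suc (Suc N). ennreal (\<delta> (\<gamma> (p' i)) (\<gamma> (p' (Suc i)))))"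
      by (simp add: p'_def add_increasing2 add_mono)
    also have "\<dots> \<le> curve_length \<delta> I \<gamma>"
    proof (rule curve_length_upper)
      show "p' i \<in> I" for i using p(2) assms(3-5) by (auto simp: p'_def)
      show "p' i \<le> p' (Suc i)" if i: "i < Suc (Suc N)" for i
      proof -
        consider "i < N" | "i = N" | "i = Suc N" using i by linarith
        then show ?thesis using p(2,3) S(1) assms(6) by cases (auto simp: p'_def)
      qed
    qed simp
    finally show "x + ennreal (\<delta> (\<gamma> s) (\<gamma> t)) \<le> curve_length \<delta> I \<gamma>" .
  qed
  finally show ?thesis .
qed

lemma curve_length_mono:
  assumes "S \<subseteq> I"
  shows "curve_length \<delta> S \<gamma> \<le> curve_length \<delta> I \<gamma>"
  unfolding curve_length_def[of \<delta> S]
proof (safe intro!: Sup_least)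
  fix N and t :: "nat \<Rightarrow> real"
  assume "N \<ge> 1" "\<forall>i\<le>N. t i \<in> S" "\<forall>i<N. t i \<le> t (Suc i)"
  then show "(\<Sum>i<N. ennreal (\<delta> (\<gamma> (t i)) (\<gamma> (t (Suc i))))) \<le> curve_length \<delta> I \<gamma>"
    using assms by (intro curve_length_upper) auto
qed

text \<open>
  Let \<open>V t\<close> be the length of the part of the curve up to time \<open>t\<close>. One step of size \<open>h\<close> contributes at
  most \<open>V (t + h) - V t\<close>. Integrated over \<open>[p, q]\<close>, this increment telescopes to at most the integral
  of \<open>V\<close> over \<open>[q, q + h]\<close>, which is at most \<open>h\<close> times the total length.
\<close>

lemma nn_integral_forward_quotient_le_curve_length:
  assumes meas: "forward_quotient \<delta> I \<gamma> n \<in> borel_measurable borel" and \<delta>: "\<And>x y. 0 \<le> \<delta> x y"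
  shows "(\<integral>\<^sup>+t. ennreal (forward_quotient \<delta> I \<gamma> n t) \<partial>lborel) \<le> curve_length \<delta> I \<gamma>"
proof (cases "curve_length \<delta> I \<gamma> = \<infinity>")
  case False
  then obtain L where L: "0 \<le> L" "curve_length \<delta> I \<gamma> = ennreal L"
    by (cases "curve_length \<delta> I \<gamma>") auto
  define h where "h = 1 / real (Suc n)"
  have h: "0 < h" by (simp add: h_def)
  define f where "f = forward_quotient \<delta> I \<gamma> n"
  have f0: "0 \<le> f t" for t using \<delta> by (simp add: f_def forward_quotient_def)
  have [measurable]: "f \<in> borel_measurable borel" unfolding f_def by (rule meas)
  define V where "V t = enn2real (curve_length \<delta> (I \<inter> {..t}) \<gamma>)" for t
  have Vle: "curve_length \<delta> (I \<inter> {..t}) \<gamma> \<le> ennreal L" for t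
    unfolding L(2)[symmetric] by (intro curve_length_mono) auto
  then have V: "ennreal (V t) = curve_length \<delta> (I \<inter> {..t}) \<gamma>" for t
    unfolding V_def using le_less_trans[OF Vle[of t]] by (intro ennreal_enn2real) simp
  have V0: "0 \<le> V t" for t by (simp add: V_def)
  have VL: "V t \<le> L" for t
    using Vle[of t] L(1) unfolding V[symmetric] by simp
  have "mono V"
  proof (rule monoI)
    fix s t :: real assume "s \<le> t"
    then have "ennreal (V s) \<le> ennreal (V t)"
      unfolding V by (intro curve_length_mono) auto
    then show "V s \<le> V t" using V0 by (simp add: ennreal_le_iff)
  qed
  then have [measurable]: "V \<in> borel_measurable borel" by (rule borel_measurable_mono)
  have step: "h * f t + V t \<le> V (t + h)" for t
  proof (cases "t \<in> I \<and> t + h \<in> I")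
    case True
    then have "ennreal (V t) + ennreal (\<delta> (\<gamma> t) (\<gamma> (t + h))) \<le> ennreal (V (t + h))"
      unfolding V using h by (intro curve_length_append) auto
    then have "V t + \<delta> (\<gamma> t) (\<gamma> (t + h)) \<le> V (t + h)"
      using V0 \<delta> by (simp add: ennreal_le_iff flip: ennreal_plus)
    moreover have "h * f t = \<delta> (\<gamma> t) (\<gamma> (t + h))"
      using True by (simp add: f_def forward_quotient_def h_def)
    ultimately show ?thesis by simp
  next
    case False
    then have "f t = 0" by (auto simp: f_def forward_quotient_def h_def)
    then show ?thesis using \<open>mono V\<close> h by (simp add: mono_def)
  qed
  have bound: "(\<integral>\<^sup>+t. ennreal (f t) * indicator {-real m..real m} t \<partial>lborel) \<le> ennreal L" for m
  proof -
    let ?p = "- real m" and ?q = "real m"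
    let ?v = "\<integral>\<^sup>+t. ennreal (V t) * indicator {?p..?q} t \<partial>lborel"
    have "?v \<le> (\<integral>\<^sup>+t. ennreal L * indicator {?p..?q} t \<partial>lborel)"
      using VL by (intro nn_integral_mono mult_right_mono ennreal_leI) auto
    also have "\<dots> < \<infinity>" by (simp add: nn_integral_cmult_indicator ennreal_mult_less_top)
    finally have v: "?v < \<infinity>" .
    have "(\<integral>\<^sup>+t. ennreal (h * f t) * indicator {?p..?q} t \<partial>lborel) + ?v =
        (\<integral>\<^sup>+t. ennreal (h * f t + V t) * indicator {?p..?q} t \<partial>lborel)"
      using f0 V0 h
      by (subst nn_integral_add[symmetric]) (auto intro!: nn_integral_cong simp: indicator_def)
    also have "\<dots> \<le> (\<integral>\<^sup>+t. ennreal (V (t + h)) * indicator {?p..?q} t \<partial>lborel)"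
      using step by (intro nn_integral_mono mult_right_mono ennreal_leI) auto
    also have "\<dots> = (\<integral>\<^sup>+t. ennreal (V t) * indicator {?p + h..?q + h} t \<partial>lborel)"
      by (subst nn_integral_real_affine[of "\<lambda>t. ennreal (V t) * indicator {?p + h..?q + h} t" 1 h])
         (auto intro!: nn_integral_cong simp: indicator_def add.commute)
    also have "\<dots> \<le> (\<integral>\<^sup>+t. ennreal (V t) * indicator {?p..?q} t + ennreal L * indicator {?q..?q + h} t \<partial>lborel)"
      using h VL by (intro nn_integral_mono) (auto simp: indicator_def ennreal_leI)
    also have "\<dots> = ?v + ennreal L * ennreal h"
      using h by (subst nn_integral_add) (auto simp: nn_integral_cmult_indicator)
    finally have "?v + (\<integral>\<^sup>+t. ennreal (h * f t) * indicator {?p..?q} t \<partial>lborel) \<le> ?v + ennreal L * ennreal h"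
      by (simp add: add.commute)
    then have "(\<integral>\<^sup>+t. ennreal (h * f t) * indicator {?p..?q} t \<partial>lborel) \<le> ennreal L * ennreal h"
      using v by (subst (asm) ennreal_add_left_cancel_le) auto
    also have "(\<integral>\<^sup>+t. ennreal (h * f t) * indicator {?p..?q} t \<partial>lborel) =
        ennreal h * (\<integral>\<^sup>+t. ennreal (f t) * indicator {?p..?q} t \<partial>lborel)"
      using f0 h by (subst nn_integral_cmult[symmetric]) (auto simp: ennreal_mult mult.assoc)
    finally have "ennreal h * (\<integral>\<^sup>+t. ennreal (f t) * indicator {?p..?q} t \<partial>lborel) \<le> ennreal h * ennreal L"
      by (simp add: mult.commute)
    then show ?thesis
      using h by (subst (asm) ennreal_mult_le_mult_iff) auto
  qed
  have "(\<integral>\<^sup>+t. ennreal (f t) \<partial>lborel) =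
      (\<integral>\<^sup>+t. (SUP m. ennreal (f t) * indicator {-real m..real m} t) \<partial>lborel)"
  proof (rule nn_integral_cong)
    fix t :: real
    obtain m where "\<bar>t\<bar> \<le> real m" using real_arch_simple by blast
    then have "ennreal (f t) = ennreal (f t) * indicator {-real m..real m} t" by (simp add: indicator_def abs_le_iff)
    also have "\<dots> \<le> (SUP m. ennreal (f t) * indicator {-real m..real m} t)" by (rule SUP_upper) simp
    finally show "ennreal (f t) = (SUP m. ennreal (f t) * indicator {-real m..real m} t)"
      by (intro antisym SUP_least) (auto simp: indicator_def)
  qed
  also have "\<dots> = (SUP m. \<integral>\<^sup>+t. ennreal (f t) * indicator {-real m..real m} t \<partial>lborel)"
    by (rule nn_integral_monotone_convergence_SUP)
       (auto intro!: incseq_SucI le_funI simp: indicator_def)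
  also have "\<dots> \<le> ennreal L" using bound by (intro SUP_least)
  finally show ?thesis by (simp add: f_def L(2))
qed simp

section \<open>Local behaviour of the weighted distance\<close>

context weighted_space
begin

lemma ennreal_weighted_dist: "ennreal (weighted_dist K x y) = lipschitz_cost K x y"
  unfolding weighted_dist_def weighted_edist_eq_lipschitz_cost
  using lipschitz_cost_finite[of x y] by (intro ennreal_enn2real) simp

lemma weighted_dist_nonneg: "0 \<le> weighted_dist K x y"
  by (simp add: weighted_dist_def)

lemma weighted_dist_commute: "weighted_dist K x y = weighted_dist K y x"
  by (simp add: weighted_dist_def weighted_edist_eq_lipschitz_cost lipschitz_cost_commute[OF K_cont, of x y])

lemma weighted_dist_self [simp]: "weighted_dist K x x = 0"
  by (simp add: weighted_dist_def weighted_edist_eq_lipschitz_cost)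

lemma weighted_dist_triangle: "weighted_dist K x z \<le> weighted_dist K x y + weighted_dist K y z"
proof -
  have "ennreal (weighted_dist K x z) \<le> ennreal (weighted_dist K x y + weighted_dist K y z)"
    using lipschitz_cost_triangle[OF K_cont, of x z y]
    by (simp add: ennreal_weighted_dist weighted_dist_nonneg)
  then show ?thesis
    by (subst (asm) ennreal_le_iff) (simp_all add: weighted_dist_nonneg add_nonneg_nonneg)
qed

lemma weighted_dist_le:
  assumes "\<And>z. dist x z \<le> dist x y \<Longrightarrow> K z \<le> M"
  shows "weighted_dist K x y \<le> M * dist x y"
proof -
  have "0 \<le> M" using assms[of x] K_nonneg[of x] by simp
  then show ?thesis
    using lipschitz_cost_le_dist[OF assms] by (simp add: ennreal_le_iff flip: ennreal_weighted_dist)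
qed

lemma weighted_dist_ge:
  assumes "\<And>z e. 0 < e \<Longrightarrow> \<forall>\<^sub>F w in nhds z. \<bar>\<Phi> w - \<Phi> z\<bar> \<le> (K z + e) * dist z w"
    and "\<And>S. bounded S \<Longrightarrow> \<exists>C. C-lipschitz_on S \<Phi>"
  shows "\<Phi> y - \<Phi> x \<le> weighted_dist K x y"
proof -
  have "ennreal (\<Phi> y - \<Phi> x) \<le> ennreal (weighted_dist K x y)"
    unfolding ennreal_weighted_dist
    using assms by (rule upper_gradient_le_lipschitz_cost[OF K_cont K_nonneg])
  then show ?thesis using weighted_dist_nonneg by (simp add: ennreal_le_iff)
qed

text \<open>
  The distance from \<open>x\<close> clamped to \<open>[r, R]\<close> varies only while the curve crosses the annulus, where
  \<open>K\<close> is at least \<open>c\<close>; hence \<open>c\<close> times it has \<open>K\<close> as an upper gradient.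
\<close>

lemma weighted_dist_ge_annulus:
  assumes "0 \<le> c" "r \<le> R" "R \<le> dist x y" "0 \<le> r"
    and c: "\<And>z. r \<le> dist x z \<Longrightarrow> dist x z \<le> R \<Longrightarrow> c \<le> K z"
  shows "c * (R - r) \<le> weighted_dist K x y"
proof -
  define \<Phi> where "\<Phi> w = c * max r (min R (dist x w))" for w
  have lip: "\<bar>\<Phi> w - \<Phi> z\<bar> \<le> c * dist z w" for w z
  proof -
    have "\<bar>dist x w - dist x z\<bar> \<le> dist z w"
      using dist_triangle[of x w z] dist_triangle[of x z w] by (simp add: dist_commute)
    then have "\<bar>max r (min R (dist x w)) - max r (min R (dist x z))\<bar> \<le> dist z w"
      by (auto simp: max_def min_def)
    then have "c * \<bar>max r (min R (dist x w)) - max r (min R (dist x z))\<bar> \<le> c * dist z w"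
      using assms(1) by (rule mult_left_mono)
    then show ?thesis
      using assms(1) by (simp add: \<Phi>_def abs_mult flip: right_diff_distrib)
  qed
  have "\<Phi> y - \<Phi> x \<le> weighted_dist K x y"
  proof (rule weighted_dist_ge)
    fix z and e :: real assume e: "0 < e"
    have lim: "((\<lambda>w. dist x w) \<longlongrightarrow> dist x z) (nhds z)" by (intro tendsto_intros filterlim_ident)
    have pos: "0 \<le> (K z + e) * dist z w" for w using K_nonneg[of z] e by simp
    consider "dist x z < r" | "r \<le> dist x z" "dist x z \<le> R" | "R < dist x z" by linarith
    then show "\<forall>\<^sub>F w in nhds z. \<bar>\<Phi> w - \<Phi> z\<bar> \<le> (K z + e) * dist z w"
    proof cases
      case 1
      have "\<forall>\<^sub>F w in nhds z. dist x w < r" using order_tendstoD(2)[OF lim 1] .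
      then show ?thesis
      proof eventually_elim
        case (elim w)
        then have "\<Phi> w = \<Phi> z" using 1 assms(2) by (simp add: \<Phi>_def)
        then show ?case using pos by simp
      qed
    next
      case 2
      have "c * dist z w \<le> (K z + e) * dist z w" for w
        using c[OF 2] e by (intro mult_right_mono) auto
      then show ?thesis using lip order.trans by (intro always_eventually allI) blast
    next
      case 3
      have "\<forall>\<^sub>F w in nhds z. R < dist x w" using order_tendstoD(1)[OF lim 3] .
      then show ?thesis
      proof eventually_elim
        case (elim w)
        then have "\<Phi> w = \<Phi> z" using 3 assms(2) by (simp add: \<Phi>_def)
        then show ?case using pos by simp
      qed
    qed
  next
    show "\<exists>C. C-lipschitz_on S \<Phi>" for S
      using lip assms(1) by (intro exI[of _ c] lipschitz_onI) (simp_all add: dist_real_def dist_commute)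
  qed
  moreover have "\<Phi> y - \<Phi> x = c * (R - r)"
    using assms by (simp add: \<Phi>_def right_diff_distrib)
  ultimately show ?thesis by simp
qed

text \<open>
  To first order \<open>d\<^sub>K\<close> is \<open>K x\<close> times \<open>d\<close> near \<open>x\<close>: geodesics give the upper bound and the annulus
  estimate with inner radius zero gives the lower one, both by continuity of \<open>K\<close>. This yields the
  metric derivative in \<open>d\<^sub>K\<close> at every point where the one in \<open>d\<close> exists.
\<close>

lemma weighted_dist_asymptotic:
  assumes "0 < e"
  shows "\<exists>d>0. \<forall>y. dist x y < d \<longrightarrow> \<bar>weighted_dist K x y - K x * dist x y\<bar> \<le> e * dist x y"
proof -
  obtain d where d: "0 < d" "\<And>z. dist z x < d \<Longrightarrow> dist (K z) (K x) < e"
    using K_cont assms unfolding continuous_on_iff by (metis UNIV_I)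
  then have K: "\<bar>K z - K x\<bar> < e" if "dist x z < d" for z
    using that by (simp add: dist_commute dist_real_def)
  have "\<bar>weighted_dist K x y - K x * dist x y\<bar> \<le> e * dist x y" if y: "dist x y < d" for y
  proof -
    have near: "K z \<le> K x + e" "K x - e \<le> K z" if "dist x z \<le> dist x y" for z
      using K[of z] y that by auto
    have "weighted_dist K x y \<le> (K x + e) * dist x y"
      using near(1) by (rule weighted_dist_le)
    moreover have "max 0 (K x - e) * (dist x y - 0) \<le> weighted_dist K x y"
      using near(2) K_nonneg by (intro weighted_dist_ge_annulus) auto
    then have "(K x - e) * dist x y \<le> weighted_dist K x y"
      using mult_right_mono[of "K x - e" "max 0 (K x - e)" "dist x y"] by simp
    ultimately show ?thesis by (simp add: abs_le_iff algebra_simps)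
  qed
  then show ?thesis using d(1) by blast
qed

lemma weighted_dist_tendsto_zero: "((\<lambda>y. weighted_dist K x y) \<longlongrightarrow> 0) (nhds x)"
proof (rule tendstoI)
  fix e :: real assume "0 < e"
  then obtain d where d: "0 < d" "\<And>y. dist x y < d \<Longrightarrow> lipschitz_cost K x y \<le> ennreal (e / 2)"
    using lipschitz_cost_small[of "e / 2" x] by auto
  have "dist (weighted_dist K x y) 0 < e" if "dist x y < d" for y
    using d(2)[OF that] \<open>0 < e\<close> weighted_dist_nonneg[of x y]
    by (simp add: ennreal_le_iff flip: ennreal_weighted_dist)
  then show "\<forall>\<^sub>F y in nhds x. dist (weighted_dist K x y) 0 < e"
    unfolding eventually_nhds_metric using d(1) by (auto simp: dist_commute)
qed

lemma continuous_on_weighted_dist: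
  assumes f: "continuous_on S f" and g: "continuous_on S g"
  shows "continuous_on S (\<lambda>t. weighted_dist K (f t) (g t))"
  unfolding continuous_on_def
proof
  fix t assume t: "t \<in> S"
  have "((\<lambda>s. weighted_dist K (f s) (g s) - weighted_dist K (f t) (g t)) \<longlongrightarrow> 0) (at t within S)"
  proof (rule tendsto_rabs_zero_cancel,
      rule tendsto_sandwich[of "\<lambda>_. 0" _ _ "\<lambda>s. weighted_dist K (f t) (f s) + weighted_dist K (g t) (g s)"])
    show "\<forall>\<^sub>F s in at t within S. \<bar>weighted_dist K (f s) (g s) - weighted_dist K (f t) (g t)\<bar>
        \<le> weighted_dist K (f t) (f s) + weighted_dist K (g t) (g s)"
    proof (intro always_eventually allI)
      fix s
      have "weighted_dist K (f s) (g s) \<le> weighted_dist K (f s) (f t) + (weighted_dist K (f t) (g t) + weighted_dist K (g t) (g s))"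
           "weighted_dist K (f t) (g t) \<le> weighted_dist K (f t) (f s) + (weighted_dist K (f s) (g s) + weighted_dist K (g s) (g t))"
        by (meson weighted_dist_triangle add_left_mono order.trans)+
      then show "\<bar>weighted_dist K (f s) (g s) - weighted_dist K (f t) (g t)\<bar>
          \<le> weighted_dist K (f t) (f s) + weighted_dist K (g t) (g s)"
        by (simp add: weighted_dist_commute[of "f s" "f t"] weighted_dist_commute[of "g s" "g t"] abs_le_iff)
    qed
    have "((\<lambda>s. weighted_dist K (f t) (f s)) \<longlongrightarrow> 0) (at t within S)"
         "((\<lambda>s. weighted_dist K (g t) (g s)) \<longlongrightarrow> 0) (at t within S)"
      using f g t
      by (auto simp: continuous_on_def intro: filterlim_compose[OF weighted_dist_tendsto_zero])
    from tendsto_add[OF this]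
    show "((\<lambda>s. weighted_dist K (f t) (f s) + weighted_dist K (g t) (g s)) \<longlongrightarrow> 0) (at t within S)" by simp
  qed auto
  then show "((\<lambda>s. weighted_dist K (f s) (g s)) \<longlongrightarrow> weighted_dist K (f t) (g t)) (at t within S)"
    by (rule LIM_zero_cancel)
qed

lemma has_metric_deriv_weighted_dist:
  assumes v: "has_metric_deriv dist I \<gamma> t v" and cont: "(\<gamma> \<longlongrightarrow> \<gamma> t) (at t within I)"
  shows "has_metric_deriv (weighted_dist K) I \<gamma> t (K (\<gamma> t) * v)"
proof -
  let ?q = "\<lambda>\<delta> s. \<delta> (\<gamma> t) (\<gamma> s) / \<bar>t - s\<bar>"
  have lim: "(?q dist \<longlongrightarrow> v) (at t within I)" using v by (simp add: has_metric_deriv_def)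
  have "((\<lambda>s. ?q (weighted_dist K) s - K (\<gamma> t) * ?q dist s) \<longlongrightarrow> 0) (at t within I)"
  proof (rule tendstoI)
    fix e :: real assume "0 < e"
    (* The quotient in d is eventually below |v| + 1, so an e'-error relative to d is below e. *)
    define e' where "e' = e / (\<bar>v\<bar> + 1)"
    have e': "0 < e'" using \<open>0 < e\<close> by (simp add: e'_def)
    then obtain d where d: "0 < d"
        "\<And>y. dist (\<gamma> t) y < d \<Longrightarrow> \<bar>weighted_dist K (\<gamma> t) y - K (\<gamma> t) * dist (\<gamma> t) y\<bar> \<le> e' * dist (\<gamma> t) y"
      using weighted_dist_asymptotic[of e' "\<gamma> t"] by blast
    have "\<forall>\<^sub>F s in at t within I. dist (\<gamma> s) (\<gamma> t) < d" using cont d(1) by (rule tendstoD)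
    moreover have "\<forall>\<^sub>F s in at t within I. ?q dist s < \<bar>v\<bar> + 1"
      using order_tendstoD(2)[OF lim, of "\<bar>v\<bar> + 1"] by auto
    ultimately show "\<forall>\<^sub>F s in at t within I. dist (?q (weighted_dist K) s - K (\<gamma> t) * ?q dist s) 0 < e"
    proof eventually_elim
      case (elim s)
      have "\<bar>?q (weighted_dist K) s - K (\<gamma> t) * ?q dist s\<bar> =
          \<bar>weighted_dist K (\<gamma> t) (\<gamma> s) - K (\<gamma> t) * dist (\<gamma> t) (\<gamma> s)\<bar> / \<bar>t - s\<bar>"
        unfolding times_divide_eq_right diff_divide_distrib[symmetric] by (simp add: abs_divide)
      also have "\<dots> \<le> (e' * dist (\<gamma> t) (\<gamma> s)) / \<bar>t - s\<bar>"
        using d(2)[of "\<gamma> s"] elim(1) by (intro divide_right_mono) (auto simp: dist_commute)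
      also have "\<dots> = e' * ?q dist s" by simp
      also have "\<dots> < e' * (\<bar>v\<bar> + 1)" using elim(2) e' by (intro mult_strict_left_mono)
      also have "\<dots> = e" by (simp add: e'_def)
      finally show ?case by simp
    qed
  qed
  from tendsto_add[OF this tendsto_mult[OF tendsto_const[of "K (\<gamma> t)"] lim]]
  show ?thesis by (simp add: has_metric_deriv_def)
qed

lemma loc_lipschitz_weighted_dist:
  assumes "loc_lipschitz dist I \<gamma>"
  shows "loc_lipschitz (weighted_dist K) I \<gamma>"
  unfolding loc_lipschitz_def
proof
  fix t assume t: "t \<in> I"
  then obtain e L where e: "0 < e" and L: "\<And>r s. r \<in> I \<inter> ball t e \<Longrightarrow> s \<in> I \<inter> ball t e \<Longrightarrow> dist (\<gamma> r) (\<gamma> s) \<le> L * \<bar>r - s\<bar>"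
    using assms unfolding loc_lipschitz_def by blast
  (* Keeps the curve within distance 1 of its value at t, so that the connecting geodesics stay in a ball of radius 3. *)
  define e' where "e' = min e (1 / (\<bar>L\<bar> + 1))"
  have e': "0 < e'" "e' \<le> e" using e by (auto simp: e'_def)
  obtain M where M: "0 < M" "\<And>z. z \<in> cball (\<gamma> t) 3 \<Longrightarrow> K z \<le> M" using bounded_above_on_ball by blast
  have close: "dist (\<gamma> t) (\<gamma> r) \<le> 1" if r: "r \<in> I \<inter> ball t e'" for r
  proof -
    have "dist (\<gamma> t) (\<gamma> r) \<le> L * \<bar>t - r\<bar>" using L[of t r] t r e' by auto
    also have "\<dots> \<le> (\<bar>L\<bar> + 1) * (1 / (\<bar>L\<bar> + 1))"
      using r by (intro mult_mono) (auto simp: e'_def dist_real_def)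
    also have "\<dots> = 1" by simp
    finally show ?thesis .
  qed
  have "weighted_dist K (\<gamma> r) (\<gamma> s) \<le> (M * L) * \<bar>r - s\<bar>"
    if r: "r \<in> I \<inter> ball t e'" and s: "s \<in> I \<inter> ball t e'" for r s
  proof -
    have "weighted_dist K (\<gamma> r) (\<gamma> s) \<le> M * dist (\<gamma> r) (\<gamma> s)"
    proof (rule weighted_dist_le)
      fix z assume "dist (\<gamma> r) z \<le> dist (\<gamma> r) (\<gamma> s)"
      moreover have "dist (\<gamma> r) (\<gamma> s) \<le> dist (\<gamma> t) (\<gamma> r) + dist (\<gamma> t) (\<gamma> s)" by (rule dist_triangle3)
      moreover have "dist (\<gamma> t) z \<le> dist (\<gamma> t) (\<gamma> r) + dist (\<gamma> r) z" by (rule dist_triangle)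
      ultimately show "K z \<le> M" using close[OF r] close[OF s] by (intro M(2)) simp
    qed
    also have "\<dots> \<le> M * (L * \<bar>r - s\<bar>)"
      using L[of r s] r s e' M(1) by (intro mult_left_mono) auto
    finally show ?thesis by (simp add: mult.assoc)
  qed
  then show "\<exists>e>0. \<exists>L. \<forall>r\<in>I \<inter> ball t e. \<forall>s\<in>I \<inter> ball t e. weighted_dist K (\<gamma> r) (\<gamma> s) \<le> L * \<bar>r - s\<bar>"
    using e'(1) by blast
qed

section \<open>The length formula\<close>

lemma weighted_length_partition_le:
  fixes p :: "nat \<Rightarrow> real"
  assumes I: "is_interval I" and \<gamma>: "almost_lipschitz I \<gamma>"
    and p: "\<And>i. i \<le> N \<Longrightarrow> p i \<in> I" "\<And>i. i < N \<Longrightarrow> p i \<le> p (Suc i)"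
  shows "p 0 \<le> p N \<and> (\<Sum>i<N. weighted_length K {p i..p (Suc i)} \<gamma>) \<le> weighted_length K {p 0..p N} \<gamma>"
  using p
proof (induction N)
  case (Suc N)
  then have IH: "p 0 \<le> p N" "(\<Sum>i<N. weighted_length K {p i..p (Suc i)} \<gamma>) \<le> weighted_length K {p 0..p N} \<gamma>"
    by auto
  have step: "p N \<le> p (Suc N)" using Suc.prems(2) by simp
  have "weighted_length K {p 0..p (Suc N)} \<gamma> = weighted_length K {p 0..p N} \<gamma> + weighted_length K {p N..p (Suc N)} \<gamma>"
    using IH(1) step Suc.prems(1)
    by (intro weighted_length_split[OF I \<gamma> K_cont] is_interval_Icc_subset[OF I]) auto
  then show ?case using IH step by (simp add: add_right_mono)
qed simp

text \<open>
  The length of the curve dominates the integrals of the difference quotients in \<open>d\<^sub>K\<close>, which converge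
  almost everywhere to the weighted speed, so Fatou's lemma bounds the weighted length. Conversely,
  each term of a partition sum is at most the weighted length of the corresponding piece, because that
  piece is a competitor for \<open>d\<^sub>K\<close>.
\<close>

theorem weighted_length_eq_curve_length:
  assumes I: "is_interval I" and \<gamma>: "almost_lipschitz I \<gamma>"
  shows "weighted_length K I \<gamma> = curve_length (weighted_dist K) I \<gamma>"
proof (rule antisym)
  have cont: "continuous_on I \<gamma>" using \<gamma> by (simp add: almost_lipschitz_def)
  let ?f = "\<lambda>n t. ennreal (forward_quotient (weighted_dist K) I \<gamma> n t)"
  have meas: "forward_quotient (weighted_dist K) I \<gamma> n \<in> borel_measurable borel" for n
    using cont
    by (intro forward_quotient_measurable[OF I] continuous_on_weighted_dist continuous_on_shift)
       (auto elim: continuous_on_subset)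
  then have meas': "?f n \<in> borel_measurable lebesgue" for n
    by (simp add: measurable_completion)
  have "weighted_length K I \<gamma> = (\<integral>\<^sup>+t\<in>I. weighted_speed K \<gamma> t \<partial>lebesgue)"
    by (rule weighted_length_eq[OF I])
  also have "\<dots> \<le> (\<integral>\<^sup>+t. liminf (\<lambda>n. ?f n t) \<partial>lebesgue)"
  proof (rule nn_integral_mono_AE)
    show "AE t in lebesgue. weighted_speed K \<gamma> t * indicator I t \<le> liminf (\<lambda>n. ?f n t)"
      using AE_has_metric_deriv[OF I \<gamma>]
    proof eventually_elim
      case (elim t)
      show ?case
      proof (cases "t \<in> I")
        case True
        then obtain v where v: "has_metric_deriv dist UNIV \<gamma> t v" and t: "t \<in> interior I" using elim by blast
        have "continuous (at t) \<gamma>" using cont t by (rule continuous_on_interior)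
        then have "has_metric_deriv (weighted_dist K) UNIV \<gamma> t (K (\<gamma> t) * v)"
          using v by (intro has_metric_deriv_weighted_dist) (auto simp: continuous_at)
        then have "(\<lambda>n. ?f n t) \<longlonglongrightarrow> ennreal (K (\<gamma> t) * v)"
          using t by (intro tendsto_ennrealI forward_quotient_tendsto)
        then have "liminf (\<lambda>n. ?f n t) = ennreal (K (\<gamma> t) * v)" by (intro lim_imp_Liminf) auto
        then show ?thesis
          using True has_metric_deriv_imp_metric_deriv[OF v] by (simp add: weighted_speed_def)
      qed simp
    qed
  qed
  also have "\<dots> \<le> liminf (\<lambda>n. \<integral>\<^sup>+t. ?f n t \<partial>lebesgue)"
    using meas' by (rule nn_integral_liminf)
  also have "\<dots> \<le> liminf (\<lambda>n::nat. curve_length (weighted_dist K) I \<gamma>)"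
    unfolding nn_integral_completion
    using nn_integral_forward_quotient_le_curve_length[OF meas weighted_dist_nonneg]
    by (intro Liminf_mono always_eventually) auto
  also have "\<dots> = curve_length (weighted_dist K) I \<gamma>" by (simp add: Liminf_const)
  finally show "weighted_length K I \<gamma> \<le> curve_length (weighted_dist K) I \<gamma>" .
  show "curve_length (weighted_dist K) I \<gamma> \<le> weighted_length K I \<gamma>"
    unfolding curve_length_def
  proof (safe intro!: Sup_least)
    fix N and p :: "nat \<Rightarrow> real"
    assume "N \<ge> 1" and p: "\<forall>i\<le>N. p i \<in> I" "\<forall>i<N. p i \<le> p (Suc i)"
    have "(\<Sum>i<N. ennreal (weighted_dist K (\<gamma> (p i)) (\<gamma> (p (Suc i))))) \<le>
        (\<Sum>i<N. weighted_length K {p i..p (Suc i)} \<gamma>)"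
      unfolding ennreal_weighted_dist using p
      by (intro sum_mono lipschitz_cost_along_curve[OF I \<gamma>]) auto
    also have "\<dots> \<le> weighted_length K {p 0..p N} \<gamma>"
      using weighted_length_partition_le[OF I \<gamma>, of N p] p by blast
    also have "\<dots> \<le> weighted_length K I \<gamma>"
      using p I by (intro weighted_length_mono is_interval_Icc_subset[OF I]) auto
    finally show "(\<Sum>i<N. ennreal (weighted_dist K (\<gamma> (p i)) (\<gamma> (p (Suc i))))) \<le> weighted_length K I \<gamma>" .
  qed
qed

section \<open>Topology and properness\<close>

text \<open>
  Only finitely many distances from \<open>x\<close> to zeros of \<open>K\<close> occur, so some thin annulus around \<open>x\<close> inside
  the ball of radius \<open>r\<close> contains no zero. By compactness \<open>K\<close> is bounded below there, and every curve
  leaving the ball crosses this annulus.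
\<close>

lemma weighted_dist_bounded_below_away:
  assumes fin: "finite {z. K z = 0}" and r: "0 < r"
  shows "\<exists>c>0. \<forall>y. r \<le> dist x y \<longrightarrow> c \<le> weighted_dist K x y"
proof -
  (* The zero at x itself, if there is one, has distance 0 and is removed. *)
  define D where "D = insert r (dist x ` {z. K z = 0} - {0})"
  have D: "finite D" "D \<noteq> {}" "\<And>s. s \<in> D \<Longrightarrow> 0 < s" using fin r by (auto simp: D_def)
  define R where "R = Min D / 2"
  have "Min D \<in> D" using D by (intro Min_in) auto
  then have R0: "0 < R" using D(3) by (simp add: R_def)
  have Rlt: "R < s" if "s \<in> D" for s
    using Min_le[OF D(1) that] D(3)[OF \<open>Min D \<in> D\<close>] by (simp add: R_def)
  let ?A = "{z. R / 2 \<le> dist x z \<and> dist x z \<le> R}"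
  have pos: "0 < K z" if "z \<in> ?A" for z
  proof (rule ccontr)
    assume "\<not> 0 < K z"
    then have "dist x z \<in> D" using K_nonneg[of z] that R0 by (auto simp: D_def)
    then show False using Rlt that by fastforce
  qed
  have "compact ?A"
  proof (rule closed_bounded_imp_compact)
    show "closed ?A" by (intro closed_Collect_conj closed_Collect_le continuous_intros)
    show "bounded ?A" by (rule bounded_subset[OF bounded_cball[of x R]]) auto
  qed
  have "\<exists>c>0. \<forall>z\<in>?A. c \<le> K z"
  proof (cases "?A = {}")
    case False
    then obtain z where "z \<in> ?A" "\<forall>w\<in>?A. K z \<le> K w"
      using continuous_attains_inf[OF \<open>compact ?A\<close>, of K] continuous_on_subset[OF K_cont] by blast
    then show ?thesis using pos by blast
  qed (auto intro: exI[of _ 1])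
  then obtain c where c: "0 < c" "\<And>z. z \<in> ?A \<Longrightarrow> c \<le> K z" by blast
  have "c * (R - R / 2) \<le> weighted_dist K x y" if "r \<le> dist x y" for y
    using R0 Rlt[of r] that c by (intro weighted_dist_ge_annulus) (auto simp: D_def)
  then show ?thesis using c(1) R0 by (intro exI[of _ "c * (R - R / 2)"]) auto
qed

theorem Metric_space_weighted_dist:
  assumes "finite {z. K z = 0}"
  shows "Metric_space UNIV (weighted_dist K)"
proof (rule Metric_space.intro)
  show "weighted_dist K x y = 0 \<longleftrightarrow> x = y" for x y
  proof
    assume 0: "weighted_dist K x y = 0"
    show "x = y"
    proof (rule ccontr)
      assume "x \<noteq> y"
      then show False
        using weighted_dist_bounded_below_away[OF assms, of "dist x y" x] 0 by force
    qed
  qed simp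
qed (rule weighted_dist_nonneg weighted_dist_commute weighted_dist_triangle)+

text \<open>
  Small \<open>d\<close>-balls lie in \<open>d\<^sub>K\<close>-balls because \<open>d\<^sub>K\<close> is continuous, and small \<open>d\<^sub>K\<close>-balls lie in
  \<open>d\<close>-balls because leaving a \<open>d\<close>-ball has a positive minimal cost. The topologies therefore agree
  on the whole space and not only on compact subsets.
\<close>

theorem mtopology_weighted_dist:
  assumes "finite {z. K z = 0}"
  shows "Metric_space.mtopology UNIV (weighted_dist K) = euclidean"
proof -
  interpret W: Metric_space UNIV "weighted_dist K" using assms by (rule Metric_space_weighted_dist)
  have "openin W.mtopology U \<longleftrightarrow> open U" for U
  proof
    assume U: "openin W.mtopology U"
    show "open U"
      unfolding open_dist
    proof
      fix x assume "x \<in> U"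
      then obtain r where r: "0 < r" "W.mball x r \<subseteq> U" using U W.openin_mtopology by blast
      have "\<forall>\<^sub>F y in nhds x. weighted_dist K x y < r"
        using order_tendstoD(2)[OF weighted_dist_tendsto_zero r(1)] .
      then obtain d where "0 < d" "\<And>y. dist y x < d \<Longrightarrow> weighted_dist K x y < r"
        unfolding eventually_nhds_metric by blast
      then show "\<exists>d>0. \<forall>y. dist y x < d \<longrightarrow> y \<in> U" using r(2) by (intro exI[of _ d]) auto
    qed
  next
    assume U: "open U"
    show "openin W.mtopology U"
      unfolding W.openin_mtopology
    proof (intro conjI allI impI)
      fix x assume "x \<in> U"
      then obtain r where r: "0 < r" "\<And>y. dist y x < r \<Longrightarrow> y \<in> U" using U unfolding open_dist by blast
      obtain c where c: "0 < c" "\<And>y. r \<le> dist x y \<Longrightarrow> c \<le> weighted_dist K x y"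
        using weighted_dist_bounded_below_away[OF assms r(1)] by blast
      have "W.mball x c \<subseteq> U"
      proof
        fix y assume "y \<in> W.mball x c"
        then have "\<not> r \<le> dist x y" using c(2)[of y] by auto
        then show "y \<in> U" using r(2)[of y] by (simp add: dist_commute)
      qed
      then show "\<exists>r>0. W.mball x r \<subseteq> U" using c(1) by blast
    qed simp
  qed
  then show ?thesis by (simp add: topology_eq)
qed

end

lemma primitive_unbounded:
  fixes k :: "real \<Rightarrow> real"
  assumes k: "continuous_on {0..} k" "\<And>t. 0 \<le> t \<Longrightarrow> 0 \<le> k t"
    and inf: "(\<integral>\<^sup>+t\<in>{0..}. ennreal (k t) \<partial>lborel) = \<infinity>"
  shows "\<exists>R\<ge>0. B < integral {0..R} k"
proof (rule ccontr)
  assume "\<not> ?thesis"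
  then have le: "integral {0..R} k \<le> B" if "0 \<le> R" for R using that by (auto simp: not_less)
  define f where "f = (\<lambda>t. indicator {0..} t *\<^sub>R k t)"
  have [measurable]: "f \<in> borel_measurable borel"
    unfolding f_def using k(1) by (intro borel_measurable_continuous_on_indicator) auto
  have "(\<integral>\<^sup>+t\<in>{0..}. ennreal (k t) \<partial>lborel) = (\<integral>\<^sup>+t. (SUP n. ennreal (f t) * indicator {0..real n} t) \<partial>lborel)"
  proof (rule nn_integral_cong)
    fix t :: real
    obtain n where "t \<le> real n" using real_arch_simple by blast
    then have "ennreal (k t) * indicator {0..} t = ennreal (f t) * indicator {0..real n} t"
      by (simp add: indicator_def f_def)
    also have "\<dots> \<le> (SUP n. ennreal (f t) * indicator {0..real n} t)" by (rule SUP_upper) simp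
    finally show "ennreal (k t) * indicator {0..} t = (SUP n. ennreal (f t) * indicator {0..real n} t)"
      by (intro antisym SUP_least) (auto simp: indicator_def f_def)
  qed
  also have "\<dots> = (SUP n. \<integral>\<^sup>+t. ennreal (f t) * indicator {0..real n} t \<partial>lborel)"
    by (rule nn_integral_monotone_convergence_SUP)
       (auto intro!: incseq_SucI le_funI simp: indicator_def)
  also have "\<dots> \<le> ennreal B"
  proof (rule SUP_least)
    fix n
    have "(k has_integral integral {0..real n} k) {0..real n}"
      by (intro integrable_integral integrable_continuous_real continuous_on_subset[OF k(1)]) auto
    then have "(\<integral>\<^sup>+t. ennreal (k t) * indicator {0..real n} t \<partial>lborel) = ennreal (integral {0..real n} k)"
      using k(2) by (intro nn_integral_has_integral_lebesgue') auto
    moreover have "(\<integral>\<^sup>+t. ennreal (f t) * indicator {0..real n} t \<partial>lborel) =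
        (\<integral>\<^sup>+t. ennreal (k t) * indicator {0..real n} t \<partial>lborel)"
      by (intro nn_integral_cong) (auto simp: f_def indicator_def)
    ultimately show "(\<integral>\<^sup>+t. ennreal (f t) * indicator {0..real n} t \<partial>lborel) \<le> ennreal B"
      using le[of "real n"] by (simp add: ennreal_leI)
  qed
  finally show False using inf by (simp add: top_unique)
qed

context weighted_space
begin

text \<open>
  The primitive of \<open>k\<close>, evaluated at the distance from \<open>\<Sigma>\<close>, has pointwise slope at most \<open>k\<close> of that
  distance, and hence \<open>K\<close> as an upper gradient.
\<close>

lemma primitive_increment_le_weighted_dist:
  fixes \<Sigma> :: "'a set" and k :: "real \<Rightarrow> real"
  assumes k: "continuous_on {0..} k" "\<And>t. 0 \<le> t \<Longrightarrow> 0 \<le> k t"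
    and K_ge: "\<And>x. k (infdist x \<Sigma>) \<le> K x"
  shows "integral {0..infdist y \<Sigma>} k - integral {0..infdist x \<Sigma>} k \<le> weighted_dist K x y"
proof -
  define H where "H t = integral {0..t} k" for t
  have deriv: "(H has_real_derivative k t) (at t within {0..R})" if "t \<in> {0..R}" for t R
    unfolding H_def using that by (intro integral_has_real_derivative continuous_on_subset[OF k(1)]) auto
  have "H (infdist y \<Sigma>) - H (infdist x \<Sigma>) \<le> weighted_dist K x y"
  proof (rule weighted_dist_ge[where \<Phi> = "\<lambda>z. H (infdist z \<Sigma>)"])
    fix z and e :: real assume "0 < e"
    define t where "t = infdist z \<Sigma>"
    have t: "t \<in> {0..t + 1}" by (simp add: t_def infdist_nonneg)
    have "(H has_derivative (*) (k t)) (at t within {0..t + 1})"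
      using deriv[OF t] by (simp add: has_field_derivative_def)
    then obtain d where d: "0 < d"
        "\<And>s. s \<in> {0..t + 1} \<Longrightarrow> \<bar>s - t\<bar> < d \<Longrightarrow> \<bar>H s - H t - k t * (s - t)\<bar> \<le> e * \<bar>s - t\<bar>"
      using \<open>0 < e\<close> unfolding has_derivative_within_alt real_norm_def by blast
    have "\<bar>H (infdist w \<Sigma>) - H t\<bar> \<le> (K z + e) * dist z w" if w: "dist w z < min d 1" for w
    proof -
      let ?s = "infdist w \<Sigma>"
      have st: "\<bar>?s - t\<bar> \<le> dist w z" unfolding t_def by (rule infdist_triangle_abs)
      then have "\<bar>H ?s - H t - k t * (?s - t)\<bar> \<le> e * \<bar>?s - t\<bar>"
        using w by (intro d(2)) (auto simp: infdist_nonneg)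
      moreover have "\<bar>k t * (?s - t)\<bar> = k t * \<bar>?s - t\<bar>"
        using k(2)[of t] by (simp add: abs_mult t_def infdist_nonneg)
      ultimately have "\<bar>H ?s - H t\<bar> \<le> (k t + e) * \<bar>?s - t\<bar>" by (simp add: distrib_right)
      also have "\<dots> \<le> (K z + e) * dist w z"
        using K_ge[of z] K_nonneg[of z] \<open>0 < e\<close> st by (intro mult_mono) (auto simp: t_def)
      finally show ?thesis by (simp add: dist_commute)
    qed
    then show "\<forall>\<^sub>F w in nhds z. \<bar>H (infdist w \<Sigma>) - H (infdist z \<Sigma>)\<bar> \<le> (K z + e) * dist z w"
      unfolding eventually_nhds_metric using d(1) by (intro exI[of _ "min d 1"]) (auto simp: t_def)
  next
    fix S :: "'a set" assume "bounded S"
    then obtain x0 r where r: "\<And>z. z \<in> S \<Longrightarrow> dist x0 z \<le> r" unfolding bounded_def by blast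
    define R where "R = infdist x0 \<Sigma> + r"
    have f: "infdist z \<Sigma> \<in> {0..R}" if "z \<in> S" for z
      using r[OF that] infdist_triangle[of z \<Sigma> x0] by (simp add: R_def infdist_nonneg dist_commute)
    have "compact (k ` {0..R})"
      by (intro compact_continuous_image continuous_on_subset[OF k(1)]) auto
    then obtain C where C: "\<And>t. t \<in> {0..R} \<Longrightarrow> \<bar>k t\<bar> \<le> C"
      using compact_imp_bounded[of "k ` {0..R}"] by (auto simp: bounded_iff simp del: atLeastAtMost_iff)
    have "(max C 0)-lipschitz_on S (\<lambda>z. H (infdist z \<Sigma>))"
    proof (rule lipschitz_onI)
      fix z w assume zw: "z \<in> S" "w \<in> S"
      have "norm (H (infdist z \<Sigma>) - H (infdist w \<Sigma>)) \<le> max C 0 * norm (infdist z \<Sigma> - infdist w \<Sigma>)"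
      proof (rule field_differentiable_bound[where S = "{0..R}" and f' = k])
        show "(H has_field_derivative k t) (at t within {0..R})" if "t \<in> {0..R}" for t
          using that by (rule deriv)
        show "norm (k t) \<le> max C 0" if "t \<in> {0..R}" for t using C[OF that] by simp
      qed (use f zw in auto)
      also have "\<dots> \<le> max C 0 * dist z w"
        using infdist_triangle_abs[of z \<Sigma> w] by (intro mult_left_mono) auto
      finally show "dist (H (infdist z \<Sigma>)) (H (infdist w \<Sigma>)) \<le> max C 0 * dist z w"
        by (simp add: dist_real_def)
    qed simp
    then show "\<exists>C. C-lipschitz_on S (\<lambda>z. H (infdist z \<Sigma>))" by blast
  qed
  then show ?thesis by (simp add: H_def)
qed

text \<open>
  As the primitive of \<open>k\<close> is unbounded, a \<open>d\<^sub>K\<close>-bounded set stays within bounded \<open>d\<close>-distance of the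
  finitely many zeros. Since the two topologies coincide, properness carries over from \<open>d\<close>.
\<close>

theorem proper_weighted_dist:
  fixes k :: "real \<Rightarrow> real"
  assumes fin: "finite {z. K z = 0}" and ne: "{z. K z = 0} \<noteq> {}"
    and k: "continuous_on {0..} k" "\<And>t. 0 \<le> t \<Longrightarrow> 0 \<le> k t"
    and inf: "(\<integral>\<^sup>+t\<in>{0..}. ennreal (k t) \<partial>lborel) = \<infinity>"
    and K_ge: "\<And>x. k (infdist x {z. K z = 0}) \<le> K x"
  shows "proper_metric_space UNIV (weighted_dist K)"
  unfolding proper_metric_space_def
proof (intro conjI allI impI)
  let ?\<Sigma> = "{z. K z = 0}"
  show metric: "Metric_space UNIV (weighted_dist K)" using fin by (rule Metric_space_weighted_dist)
  interpret W: Metric_space UNIV "weighted_dist K" by (rule metric)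
  fix S assume S: "W.mbounded S \<and> closedin W.mtopology S"
  then have "closed S" by (simp add: mtopology_weighted_dist[OF fin])
  obtain x B where B: "\<And>y. y \<in> S \<Longrightarrow> weighted_dist K x y \<le> B"
    using S unfolding W.mbounded_def W.mcball_def by blast
  obtain R where R: "0 \<le> R" "B + integral {0..infdist x ?\<Sigma>} k < integral {0..R} k"
    using primitive_unbounded[OF k inf] by blast
  have far: "infdist y ?\<Sigma> < R" if "y \<in> S" for y
  proof (rule ccontr)
    assume "\<not> infdist y ?\<Sigma> < R"
    then have "integral {0..R} k \<le> integral {0..infdist y ?\<Sigma>} k"
      using k(2) by (intro integral_subset_le integrable_continuous_real continuous_on_subset[OF k(1)]) auto
    then show False
      using primitive_increment_le_weighted_dist[OF k K_ge, of y x] B[OF that] R(2) by simp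
  qed
  have "S \<subseteq> (\<Union>z\<in>?\<Sigma>. cball z R)"
  proof
    fix y assume "y \<in> S"
    have "Inf (dist y ` ?\<Sigma>) < R" using far[OF \<open>y \<in> S\<close>] ne by (simp add: infdist_notempty)
    then obtain z where "z \<in> ?\<Sigma>" "dist y z < R" using ne by (auto dest!: cInf_lessD[rotated])
    then show "y \<in> (\<Union>z\<in>?\<Sigma>. cball z R)" by (auto simp: dist_commute intro: less_imp_le)
  qed
  then have "bounded S" by (rule bounded_subset[rotated]) (use fin in auto)
  then show "compactin W.mtopology S"
    using \<open>closed S\<close> closed_bounded_imp_compact by (simp add: mtopology_weighted_dist[OF fin])
qed

end

section \<open>Properties of the weighted distance\<close>

theorem proposition2:
  fixes K :: "'a::metric_space \<Rightarrow> real" and k :: "real \<Rightarrow> real"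
  assumes proper: "proper_metric_space (UNIV :: 'a set) dist"
    and length_sp: "length_space TYPE('a)"
    and K_nonneg: "\<And>x. K x \<ge> 0"
    and K_cont: "continuous_on UNIV K"
    and Sigma_finite: "finite {z. K z = 0}"
    and Sigma_nonempty: "{z. K z = 0} \<noteq> {}"
    and k_cont: "continuous_on {0..} k"
    and k_nonneg: "\<And>t. t \<ge> 0 \<Longrightarrow> k t \<ge> 0"
    and k_int: "(\<integral>\<^sup>+t\<in>{0..}. ennreal (k t) \<partial>lborel) = \<infinity>"
    and K_ge: "\<And>x. K x \<ge> k (infdist x {z. K z = 0})"
  shows
    "((\<forall>x y. weighted_edist K x y < \<infinity>) \<and> Metric_space UNIV (weighted_dist K)) \<and>
     (\<forall>S :: 'a set. compact S \<longrightarrow>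
        subtopology (Metric_space.mtopology UNIV (weighted_dist K)) S = top_of_set S) \<and>
     proper_metric_space UNIV (weighted_dist K) \<and>
     (\<forall>I (\<gamma> :: real \<Rightarrow> 'a). is_interval I \<and> I \<noteq> {} \<and> loc_lipschitz dist I \<gamma> \<longrightarrow>
        loc_lipschitz (weighted_dist K) I \<gamma> \<and>
        (AE t in lebesgue. t \<in> I \<longrightarrow>
           has_metric_deriv (weighted_dist K) I \<gamma> t (K (\<gamma> t) * metric_deriv dist I \<gamma> t))) \<and>
     (\<forall>I (\<gamma> :: real \<Rightarrow> 'a). is_interval I \<and> I \<noteq> {} \<and> piecewise_loc_lipschitz I \<gamma> \<longrightarrow>
        weighted_length K I \<gamma> = curve_length (weighted_dist K) I \<gamma>)"
proof -
  interpret weighted_space "TYPE('a)" K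
    using proper length_sp K_nonneg K_cont by unfold_locales
  show ?thesis
  proof (intro conjI allI impI; (elim conjE)?)
    show "weighted_edist K x y < \<infinity>" for x y
      using lipschitz_cost_finite by (simp add: weighted_edist_eq_lipschitz_cost)
    show "Metric_space UNIV (weighted_dist K)"
      using Sigma_finite by (rule Metric_space_weighted_dist)
    show "subtopology (Metric_space.mtopology UNIV (weighted_dist K)) S = top_of_set S" for S
      by (simp add: mtopology_weighted_dist[OF Sigma_finite])
    show "proper_metric_space UNIV (weighted_dist K)"
      using Sigma_finite Sigma_nonempty k_cont k_nonneg k_int K_ge by (rule proper_weighted_dist)
  next
    fix I and \<gamma> :: "real \<Rightarrow> 'a"
    assume I: "is_interval I" and \<gamma>: "loc_lipschitz dist I \<gamma>"
    show "loc_lipschitz (weighted_dist K) I \<gamma>" using \<gamma> by (rule loc_lipschitz_weighted_dist)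
    show "AE t in lebesgue. t \<in> I \<longrightarrow>
        has_metric_deriv (weighted_dist K) I \<gamma> t (K (\<gamma> t) * metric_deriv dist I \<gamma> t)"
      using AE_has_metric_deriv[OF I loc_lipschitz_imp_almost_lipschitz[OF \<gamma>]]
    proof eventually_elim
      case (elim t)
      show ?case
      proof
        assume "t \<in> I"
        then obtain v where t: "t \<in> interior I" and v: "has_metric_deriv dist UNIV \<gamma> t v"
          using elim by blast
        have "metric_deriv dist I \<gamma> t = v"
          using metric_deriv_interior[OF t, of dist \<gamma>] has_metric_deriv_imp_metric_deriv[OF v] by simp
        moreover have "(\<gamma> \<longlongrightarrow> \<gamma> t) (at t within I)"
          using loc_lipschitz_imp_continuous_on[OF \<gamma>] \<open>t \<in> I\<close> by (simp add: continuous_on_def)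
        moreover have "has_metric_deriv dist I \<gamma> t v"
          using v unfolding has_metric_deriv_interior[OF t] .
        ultimately show "has_metric_deriv (weighted_dist K) I \<gamma> t (K (\<gamma> t) * metric_deriv dist I \<gamma> t)"
          using has_metric_deriv_weighted_dist by blast
      qed
    qed
  next
    fix I and \<gamma> :: "real \<Rightarrow> 'a"
    assume "is_interval I" "piecewise_loc_lipschitz I \<gamma>"
    then show "weighted_length K I \<gamma> = curve_length (weighted_dist K) I \<gamma>"
      by (intro weighted_length_eq_curve_length piecewise_imp_almost_lipschitz)
  qed
qed

end
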